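(* Fix an integer $r \ge 2$ and a parameter vector $\theta = (\mu, \sigma, \xi)$ with $\mu \in \mathbb{R}$, $\sigma > 0$, $\xi \in \mathbb{R}$. Let $(X_{i1}, \ldots, X_{ir})$, $i = 1, \ldots, n$, be independent and identically distributed random vectors, each following the GEV$_r(\mu,\sigma,\xi)$ distribution, and assume that the null hypothesis $H_0^{(r-1)}$ holds, i.e. that the $r-1$ largest order statistics $(X_{i1},\ldots,X_{i,r-1})$ follow the GEV$_{r-1}(\mu,\sigma,\xi)$ distribution. Let $z_{ij} = (X_{ij} - \mu)/\sigma$ and $$Y_{ir}(\theta) = -\log\sigma - (1+\xi z_{ir})^{-1/\xi} + (1+\xi z_{i,r-1})^{-1/\xi} - \Bigl(\frac{1}{\xi}+1\Bigr)\log(1+\xi z_{ir}),$$ (for $\xi = 0$ interpreted as its limit $\xi \to 0$, namely $-\log\sigma - e^{-z_{ir}} + e^{-z_{i,r-1}} - z_{ir}$). Let $\bar Y_r = \frac1n\sum_{i=1}^n Y_{ir}(\theta)$, $S_{Y_r}^2 = \frac{1}{n-1}\sum_{i=1}^n (Y_{ir}(\theta) - \bar Y_r)^2$, $\eta_r = -\log\sigma - 1 + (1+\xi)\psi(r)$, where $\psi(x) = \frac{d}{dx}\log\Gamma(x)$ is the digamma function, and $$T_n^{(r)}(\theta) = \sqrt{n}\,(\bar Y_r - \eta_r)/S_{Y_r}.$$ Then $T_n^{(r)}(\theta)$ converges in distribution to $N(0,1)$ as $n \to \infty$.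
   Context: The GEV$_r(\mu,\sigma,\xi)$ distribution (limiting joint distribution of the $r$ largest order statistics of a sample) is the distribution on $\{(x_1,\ldots,x_r): x_1 > x_2 > \cdots > x_r,\ 1+\xi z_j > 0 \text{ for all } j\}$, $z_j = (x_j-\mu)/\sigma$, with density $$f_r(x_1,\ldots,x_r \mid \mu,\sigma,\xi) = \sigma^{-r}\exp\Big\{-(1+\xi z_r)^{-1/\xi} - \Bigl(\frac1\xi + 1\Bigr)\sum_{j=1}^r \log(1+\xi z_j)\Big\},$$ with the case $\xi = 0$ understood as the limit $\xi\to 0$, i.e. $\sigma^{-r}\exp\{-e^{-z_r} - \sum_{j=1}^r z_j\}$. For $r=1$ this is the generalized extreme value (GEV) distribution. The quantity $Y_{ir}(\theta)$ is the difference of the GEV$_r$ and GEV$_{r-1}$ log-likelihood contributions of block $i$. *)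

theory Defs
  imports "HOL-Probability.Probability"
begin

definition gev_z :: "real \<Rightarrow> real \<Rightarrow> real \<Rightarrow> real" where
  "gev_z \<mu> \<sigma> x = (x - \<mu>) / \<sigma>"

(* Support of GEV_r: x_1 > x_2 > ... > x_r and 1 + xi z_j > 0 for all j.
   Vectors in R^r are functions nat => real, coordinates j = 1..r. *)
definition gevr_support :: "nat \<Rightarrow> real \<Rightarrow> real \<Rightarrow> real \<Rightarrow> (nat \<Rightarrow> real) \<Rightarrow> bool" where
  "gevr_support r \<mu> \<sigma> \<xi> x \<longleftrightarrow>
     (\<forall>j\<in>{1..<r}. x (Suc j) < x j) \<and> (\<forall>j\<in>{1..r}. 1 + \<xi> * gev_z \<mu> \<sigma> (x j) > 0)"

(* Density of GEV_r(mu, sigma, xi) w.r.t. Lebesgue measure on R^r; xi = 0 is the Gumbel limit *)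
definition gevr_density :: "nat \<Rightarrow> real \<Rightarrow> real \<Rightarrow> real \<Rightarrow> (nat \<Rightarrow> real) \<Rightarrow> real" where
  "gevr_density r \<mu> \<sigma> \<xi> x =
     (if gevr_support r \<mu> \<sigma> \<xi> x then
        (if \<xi> = 0 then
           (1 / \<sigma> ^ r) * exp (- exp (- gev_z \<mu> \<sigma> (x r)) - (\<Sum>j=1..r. gev_z \<mu> \<sigma> (x j)))
         else
           (1 / \<sigma> ^ r) * exp (- ((1 + \<xi> * gev_z \<mu> \<sigma> (x r)) powr (- 1 / \<xi>))
              - (1 / \<xi> + 1) * (\<Sum>j=1..r. ln (1 + \<xi> * gev_z \<mu> \<sigma> (x j)))))
      else 0)"

definition GEVr :: "nat \<Rightarrow> real \<Rightarrow> real \<Rightarrow> real \<Rightarrow> (nat \<Rightarrow> real) measure" where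
  "GEVr r \<mu> \<sigma> \<xi> = density (PiM {1..r} (\<lambda>_. lborel)) (\<lambda>x. ennreal (gevr_density r \<mu> \<sigma> \<xi> x))"

definition gev_Y :: "real \<Rightarrow> real \<Rightarrow> real \<Rightarrow> real \<Rightarrow> real \<Rightarrow> real" where
  "gev_Y \<mu> \<sigma> \<xi> xrm1 xr =
     (if \<xi> = 0 then
        - ln \<sigma> - exp (- gev_z \<mu> \<sigma> xr) + exp (- gev_z \<mu> \<sigma> xrm1) - gev_z \<mu> \<sigma> xr
      else
        - ln \<sigma> - (1 + \<xi> * gev_z \<mu> \<sigma> xr) powr (- 1 / \<xi>)
          + (1 + \<xi> * gev_z \<mu> \<sigma> xrm1) powr (- 1 / \<xi>)
          - (1 / \<xi> + 1) * ln (1 + \<xi> * gev_z \<mu> \<sigma> xr))"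

definition gev_eta :: "nat \<Rightarrow> real \<Rightarrow> real \<Rightarrow> real" where
  "gev_eta r \<sigma> \<xi> = - ln \<sigma> - 1 + (1 + \<xi>) * Digamma (real r)"

definition gev_T :: "nat \<Rightarrow> real \<Rightarrow> (nat \<Rightarrow> real) \<Rightarrow> real" where
  "gev_T n \<eta> Yv =
     (let Ybar = (\<Sum>i<n. Yv i) / real n;
          S2 = (\<Sum>i<n. (Yv i - Ybar)\<^sup>2) / (real n - 1)
      in sqrt (real n) * (Ybar - \<eta>) / sqrt S2)"

end

theory Submission
  imports Defs
begin

text \<open>
  Put \<open>u\<^sub>j = (1 + \<xi> z\<^sub>j) powr (- 1 / \<xi>)\<close>, or \<open>exp (- z\<^sub>j)\<close> if \<open>\<xi> = 0\<close>. This turns the \<open>GEV\<^sub>r\<close> law into the law of the first \<open>r\<close> points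
  \<open>u\<^sub>1 < \<dots> < u\<^sub>r\<close> of a unit-rate Poisson process, so \<open>u\<^sub>r\<close> is Gamma distributed with shape \<open>r\<close>
  (and \<open>u\<^bsub>r-1\<^esub>\<close> with shape \<open>r - 1\<close>), while
  \<open>Y\<^sub>r = - ln \<sigma> - u\<^sub>r + u\<^bsub>r-1\<^esub> + (1 + \<xi>) ln u\<^sub>r\<close>. Hence the mean is \<open>\<eta>\<^sub>r\<close>, all moments are finite, and the
  variance is positive because for fixed other coordinates \<open>Y\<^sub>r\<close> is injective in \<open>x\<^bsub>r-1\<^esub>\<close>. The claim is then the
  central limit theorem combined with the weak law for the sample variance and Slutsky's theorem.
\<close>

section \<open>The studentized central limit theorem\<close>

definition converges_in_prob :: "'a measure \<Rightarrow> (nat \<Rightarrow> 'a \<Rightarrow> real) \<Rightarrow> real \<Rightarrow> bool" where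
  "converges_in_prob M X c \<longleftrightarrow>
     (\<forall>e>0. (\<lambda>n. measure M {\<omega>\<in>space M. e < \<bar>X n \<omega> - c\<bar>}) \<longlonglongrightarrow> 0)"

lemma converges_in_probD:
  "converges_in_prob M X c \<Longrightarrow> e > 0 \<Longrightarrow>
    (\<lambda>n. measure M {\<omega>\<in>space M. e < \<bar>X n \<omega> - c\<bar>}) \<longlonglongrightarrow> 0"
  by (simp add: converges_in_prob_def)

lemma squeeze_to_zero:
  fixes f g :: "nat \<Rightarrow> real"
  assumes "\<And>n. 0 \<le> f n" "eventually (\<lambda>n. f n \<le> g n) sequentially" "g \<longlonglongrightarrow> 0"
  shows "f \<longlonglongrightarrow> 0"
  using assms(2) by (intro Lim_null_comparison[OF _ assms(3)]) (auto simp: assms(1))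

text \<open>The ramp has slope \<open>1 / (y - x)\<close> in absolute value, and clearing that
  denominator leaves piecewise linear cases. The bound turns closeness of two variables into
  closeness of test integrals.\<close>

lemma cts_step_Lipschitz:
  assumes "x < y"
  shows "\<bar>cts_step x y s - cts_step x y t\<bar> \<le> \<bar>s - t\<bar> / (y - x)"
proof -
  have "(y - x) * \<bar>cts_step x y s - cts_step x y t\<bar> = \<bar>(y - x) * cts_step x y s - (y - x) * cts_step x y t\<bar>"
    using assms by (simp add: abs_mult flip: right_diff_distrib)
  also have "\<dots> \<le> \<bar>s - t\<bar>"
    using assms by (auto simp: cts_step_def)
  finally show ?thesis using assms by (simp add: field_simps)
qed

context prob_space
begin

text \<open>Chebyshev's inequality; the weak law below is reduced to it.\<close>

lemma converges_in_probI_second_moment: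
  assumes [measurable]: "\<And>n. X n \<in> borel_measurable M"
    and int: "\<And>n. integrable M (\<lambda>\<omega>. (X n \<omega> - c)\<^sup>2)"
    and lim: "(\<lambda>n. expectation (\<lambda>\<omega>. (X n \<omega> - c)\<^sup>2)) \<longlonglongrightarrow> 0"
  shows "converges_in_prob M X c"
  unfolding converges_in_prob_def
proof (intro allI impI)
  fix e :: real assume e: "e > 0"
  have "measure M {\<omega>\<in>space M. e < \<bar>X n \<omega> - c\<bar>} \<le> expectation (\<lambda>\<omega>. (X n \<omega> - c)\<^sup>2) / e\<^sup>2" for n
  proof -
    have "measure M {\<omega>\<in>space M. e < \<bar>X n \<omega> - c\<bar>} \<le> measure M {\<omega>\<in>space M. e \<le> \<bar>X n \<omega> - c\<bar>}"
      by (intro finite_measure_mono) auto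
    also have "\<dots> \<le> expectation (\<lambda>\<omega>. (X n \<omega> - c)\<^sup>2) / e\<^sup>2"
      by (rule second_moment_method) (use e int in auto)
    finally show ?thesis .
  qed
  moreover have "(\<lambda>n. expectation (\<lambda>\<omega>. (X n \<omega> - c)\<^sup>2) / e\<^sup>2) \<longlonglongrightarrow> 0"
    using lim by (rule tendsto_divide_zero)
  ultimately show "(\<lambda>n. measure M {\<omega>\<in>space M. e < \<bar>X n \<omega> - c\<bar>}) \<longlonglongrightarrow> 0"
    by (intro squeeze_to_zero[OF measure_nonneg always_eventually]) simp_all
qed

text \<open>Lets a deterministic factor such as \<open>sqrt ((real n - 1) / real n)\<close> enter
  the two-variable continuous mapping lemma as a random sequence.\<close>

lemma converges_in_prob_const:
  assumes "a \<longlonglongrightarrow> c"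
  shows "converges_in_prob M (\<lambda>n \<omega>. a n) c"
  unfolding converges_in_prob_def
proof (intro allI impI)
  fix e :: real assume e: "e > 0"
  have "eventually (\<lambda>n. \<bar>a n - c\<bar> < e) sequentially"
    using tendstoD[OF assms e] by (simp add: dist_real_def)
  then have "eventually (\<lambda>n. measure M {\<omega>\<in>space M. e < \<bar>a n - c\<bar>} = 0) sequentially"
    by eventually_elim auto
  then show "(\<lambda>n. measure M {\<omega>\<in>space M. e < \<bar>a n - c\<bar>}) \<longlonglongrightarrow> 0"
    by (rule tendsto_eventually)
qed

text \<open>Continuous mapping at a constant limit: continuity at the point \<open>(a, b)\<close>
  confines large deviations of \<open>f\<close> to the events where \<open>X n\<close> or
  \<open>Y n\<close> is far from its own limit.\<close>

lemma converges_in_prob_continuous2: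
  assumes [measurable]: "\<And>n. X n \<in> borel_measurable M" "\<And>n. Y n \<in> borel_measurable M"
    and X: "converges_in_prob M X a" and Y: "converges_in_prob M Y b"
    and f: "isCont (\<lambda>p. f (fst p) (snd p)) (a, b)"
  shows "converges_in_prob M (\<lambda>n \<omega>. f (X n \<omega>) (Y n \<omega>)) (f a b)"
  unfolding converges_in_prob_def
proof (intro allI impI)
  fix e :: real assume e: "e > 0"
  obtain d where d: "d > 0" and dd: "\<And>p. dist p (a, b) < d \<Longrightarrow> \<bar>f (fst p) (snd p) - f a b\<bar> < e"
    using f e unfolding continuous_at_eps_delta by (fastforce simp: dist_real_def)
  \<comment> \<open>With thresholds \<open>d / 3\<close> the two coordinate distances add up to at
    most \<open>2 * d / 3\<close>, strictly below \<open>d\<close>.\<close>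
  let ?A = "\<lambda>n. {\<omega>\<in>space M. d / 3 < \<bar>X n \<omega> - a\<bar>}" and ?B = "\<lambda>n. {\<omega>\<in>space M. d / 3 < \<bar>Y n \<omega> - b\<bar>}"
  have "measure M {\<omega>\<in>space M. e < \<bar>f (X n \<omega>) (Y n \<omega>) - f a b\<bar>} \<le> measure M (?A n) + measure M (?B n)" for n
  proof -
    have "{\<omega>\<in>space M. e < \<bar>f (X n \<omega>) (Y n \<omega>) - f a b\<bar>} \<subseteq> ?A n \<union> ?B n"
    proof (rule subsetI, rule ccontr)
      fix \<omega> assume w: "\<omega> \<in> {\<omega>\<in>space M. e < \<bar>f (X n \<omega>) (Y n \<omega>) - f a b\<bar>}" "\<omega> \<notin> ?A n \<union> ?B n"
      have "dist (X n \<omega>, Y n \<omega>) (a, b) \<le> dist (X n \<omega>) a + dist (Y n \<omega>) b"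
        unfolding dist_Pair_Pair by (rule sqrt_sum_squares_le_sum) auto
      also have "\<dots> < d" using w d by (auto simp: dist_real_def)
      finally show False using dd[of "(X n \<omega>, Y n \<omega>)"] w by auto
    qed
    then have "measure M {\<omega>\<in>space M. e < \<bar>f (X n \<omega>) (Y n \<omega>) - f a b\<bar>} \<le> measure M (?A n \<union> ?B n)"
      by (intro finite_measure_mono) auto
    also have "\<dots> \<le> measure M (?A n) + measure M (?B n)"
      by (intro measure_Un_le) auto
    finally show ?thesis .
  qed
  moreover have "(\<lambda>n. measure M (?A n) + measure M (?B n)) \<longlonglongrightarrow> 0"
    using d by (intro tendsto_add_zero converges_in_probD[OF X] converges_in_probD[OF Y]) auto
  ultimately show "(\<lambda>n. measure M {\<omega>\<in>space M. e < \<bar>f (X n \<omega>) (Y n \<omega>) - f a b\<bar>}) \<longlonglongrightarrow> 0"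
    by (intro squeeze_to_zero[OF measure_nonneg always_eventually]) simp_all
qed

section \<open>Second moments of independent sums and the weak law\<close>

text \<open>Independent centred variables are orthogonal, so the cross terms vanish. Integrability
  is part of the induction because linearity of the expectation needs it at each step.\<close>

lemma square_sum_indep_vars:
  fixes X :: "'i \<Rightarrow> 'a \<Rightarrow> real"
  assumes "finite I" and "indep_vars (\<lambda>_. borel) X I"
    and "\<And>i. i \<in> I \<Longrightarrow> expectation (X i) = 0"
    and "\<And>i. i \<in> I \<Longrightarrow> integrable M (\<lambda>\<omega>. (X i \<omega>)\<^sup>2)"
  shows "integrable M (\<lambda>\<omega>. (\<Sum>i\<in>I. X i \<omega>)\<^sup>2) \<and>
    expectation (\<lambda>\<omega>. (\<Sum>i\<in>I. X i \<omega>)\<^sup>2) = (\<Sum>i\<in>I. expectation (\<lambda>\<omega>. (X i \<omega>)\<^sup>2))"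
  using assms
proof (induction I rule: finite_induct)
  case empty
  then show ?case by simp
next
  case (insert i I)
  have rv[measurable]: "X j \<in> borel_measurable M" if "j \<in> insert i I" for j
    using insert.prems(1) that by (auto simp: indep_vars_def)
  have intX: "integrable M (X j)" if "j \<in> insert i I" for j
    using insert.prems(3)[OF that] rv[OF that] by (rule square_integrable_imp_integrable[rotated])
  have "indep_vars (\<lambda>_. borel) X I"
    using insert.prems(1) by (rule indep_vars_subset) auto
  then have IH: "integrable M (\<lambda>\<omega>. (\<Sum>i\<in>I. X i \<omega>)\<^sup>2)"
    "expectation (\<lambda>\<omega>. (\<Sum>i\<in>I. X i \<omega>)\<^sup>2) = (\<Sum>i\<in>I. expectation (\<lambda>\<omega>. (X i \<omega>)\<^sup>2))"
    using insert by auto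
  have ind: "indep_var borel (X i) borel (\<lambda>\<omega>. \<Sum>i\<in>I. X i \<omega>)"
    using insert by (intro indep_vars_sum) auto
  \<comment> \<open>Independence factorises the expectation, and the factor \<open>X i\<close> has
    mean 0.\<close>
  have cross: "expectation (\<lambda>\<omega>. X i \<omega> * (\<Sum>i\<in>I. X i \<omega>)) = 0"
    using insert.prems(2) intX ind by (subst indep_var_lebesgue_integral) auto
  have cint: "integrable M (\<lambda>\<omega>. X i \<omega> * (\<Sum>i\<in>I. X i \<omega>))"
    using intX ind by (intro indep_var_integrable) auto
  have eq: "(\<Sum>j\<in>insert i I. X j \<omega>)\<^sup>2 = (X i \<omega>)\<^sup>2 + 2 * (X i \<omega> * (\<Sum>i\<in>I. X i \<omega>)) + (\<Sum>i\<in>I. X i \<omega>)\<^sup>2" for \<omega>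
    using insert by (simp add: power2_sum)
  show ?case
    unfolding eq using IH cross cint insert by simp
qed

text \<open>The average has mean square deviation at most \<open>v / n\<close> from
  \<open>m\<close>, by orthogonality of the centred variables.\<close>

theorem weak_law_of_large_numbers:
  fixes X :: "nat \<Rightarrow> 'a \<Rightarrow> real"
  assumes indep: "indep_vars (\<lambda>_. borel) X UNIV"
    and sq: "\<And>i. integrable M (\<lambda>\<omega>. (X i \<omega>)\<^sup>2)"
    and mean: "\<And>i. expectation (X i) = m"
    and var: "\<And>i. variance (X i) \<le> v"
  shows "converges_in_prob M (\<lambda>n \<omega>. (\<Sum>i<n. X i \<omega>) / real n) m"
proof -
  have rv[measurable]: "X i \<in> borel_measurable M" for i
    using indep by (auto simp: indep_vars_def)
  have intX: "integrable M (X i)" for i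
    using rv sq by (rule square_integrable_imp_integrable)
  let ?X = "\<lambda>i \<omega>. X i \<omega> - m"
  have sq': "integrable M (\<lambda>\<omega>. (?X i \<omega>)\<^sup>2)" for i
    unfolding power2_diff using sq intX by simp
  have "indep_vars (\<lambda>_. borel) ?X UNIV"
    using indep by (rule indep_vars_compose2) auto
  then have "indep_vars (\<lambda>_. borel) ?X {..<n}" for n
    by (rule indep_vars_subset) auto
  then have *: "integrable M (\<lambda>\<omega>. (\<Sum>i<n. ?X i \<omega>)\<^sup>2)"
    "expectation (\<lambda>\<omega>. (\<Sum>i<n. ?X i \<omega>)\<^sup>2) = (\<Sum>i<n. variance (X i))" for n
    using square_sum_indep_vars[of "{..<n}" ?X] sq' intX mean by (auto simp: prob_space)
  \<comment> \<open>At \<open>n = 0\<close> the average is 0 by the convention for division by zero,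
    so this identity is restricted to positive \<open>n\<close> and the limit uses it only
    eventually.\<close>
  have dev: "(\<Sum>i<n. X i \<omega>) / real n - m = (\<Sum>i<n. ?X i \<omega>) / real n" if "n > 0" for n \<omega>
    using that by (simp add: sum_subtractf field_simps)
  let ?S = "\<lambda>n \<omega>. (\<Sum>i<n. X i \<omega>) / real n"
  show ?thesis
  proof (rule converges_in_probI_second_moment)
    show "integrable M (\<lambda>\<omega>. (?S n \<omega> - m)\<^sup>2)" for n
      using *(1)[of n] dev[of n] by (cases "n = 0") (auto simp: power_divide)
    have "v \<ge> 0" using var[of 0] variance_positive[of "X 0"] by linarith
    have le: "expectation (\<lambda>\<omega>. (?S n \<omega> - m)\<^sup>2) \<le> v / n" if "n > 0" for n
    proof -
      have "expectation (\<lambda>\<omega>. (?S n \<omega> - m)\<^sup>2) = (\<Sum>i<n. variance (X i)) / n\<^sup>2"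
        using dev[OF that] *(2)[of n] by (simp add: power_divide)
      also have "\<dots> \<le> (n * v) / n\<^sup>2"
        using sum_bounded_above[of "{..<n}" "\<lambda>i. variance (X i)" v] var
        by (intro divide_right_mono) auto
      finally show ?thesis using that by (simp add: power2_eq_square)
    qed
    have ev: "eventually (\<lambda>n. expectation (\<lambda>\<omega>. (?S n \<omega> - m)\<^sup>2) \<le> v / n) sequentially"
      using eventually_gt_at_top[of "0::nat"] by eventually_elim (rule le)
    show "(\<lambda>n. expectation (\<lambda>\<omega>. (?S n \<omega> - m)\<^sup>2)) \<longlonglongrightarrow> 0"
      by (rule squeeze_to_zero[OF _ ev lim_const_over_n]) simp
  qed measurable
qed

section \<open>Slutsky's theorem\<close>

text \<open>Weak convergence can be tested on the ramps \<open>cts_step x y\<close>. These are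
  bounded and Lipschitz, so their expectations at \<open>X n\<close> and \<open>Y n\<close> differ
  by little once \<open>Y n - X n\<close> is small with high probability.\<close>

lemma weak_conv_m_of_diff_converges_in_prob:
  assumes [measurable]: "\<And>n. X n \<in> borel_measurable M" "\<And>n. Y n \<in> borel_measurable M"
    and N: "real_distribution N"
    and conv: "weak_conv_m (\<lambda>n. distr M borel (X n)) N"
    and diff: "converges_in_prob M (\<lambda>n \<omega>. Y n \<omega> - X n \<omega>) 0"
  shows "weak_conv_m (\<lambda>n. distr M borel (Y n)) N"
proof -
  have rd: "real_distribution (distr M borel (X n))" "real_distribution (distr M borel (Y n))" for n
    by simp_all
  show ?thesis
  proof (rule integral_cts_step_conv_imp_weak_conv[OF rd(2) N])
    fix x y :: real assume xy: "x < y"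
    have [measurable]: "cts_step x y \<in> borel_measurable borel"
      by (simp add: cts_step_def[abs_def])
    have cont: "isCont (cts_step x y) t" for t
      using uniformly_continuous_imp_continuous[OF cts_step_uniformly_continuous[OF xy]]
      by (simp add: continuous_on_eq_continuous_at)
    have unit: "0 \<le> cts_step x y t \<and> cts_step x y t \<le> 1" for t
      using xy by (auto simp: cts_step_def field_simps)
    then have bdd: "norm (cts_step x y t) \<le> 1" for t
      by simp
    have "(\<lambda>n. integral\<^sup>L (distr M borel (X n)) (cts_step x y)) \<longlonglongrightarrow> integral\<^sup>L N (cts_step x y)"
      by (rule weak_conv_imp_integral_bdd_continuous_conv[OF rd(1) N conv cont bdd])
    then have lim: "(\<lambda>n. expectation (\<lambda>\<omega>. cts_step x y (X n \<omega>))) \<longlonglongrightarrow> integral\<^sup>L N (cts_step x y)"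
      by (simp add: integral_distr)
    have int: "integrable M (\<lambda>\<omega>. cts_step x y (Z \<omega>))" if "Z \<in> borel_measurable M" for Z
      using that by (intro integrable_const_bound[of _ 1]) (auto simp: bdd[simplified])
    have "(\<lambda>n. expectation (\<lambda>\<omega>. cts_step x y (Y n \<omega>)) - expectation (\<lambda>\<omega>. cts_step x y (X n \<omega>))) \<longlonglongrightarrow> 0"
    proof (rule tendstoI)
      fix e :: real assume e: "e > 0"
      \<comment> \<open>Chosen so that the Lipschitz bound gives exactly \<open>e / 2\<close> when
        the two variables are within \<open>d\<close>.\<close>
      define d where "d = e / 2 * (y - x)"
      have d: "d > 0" using e xy by (simp add: d_def)
      let ?A = "\<lambda>n. {\<omega>\<in>space M. d < \<bar>Y n \<omega> - X n \<omega>\<bar>}"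
      have bound: "\<bar>expectation (\<lambda>\<omega>. cts_step x y (Y n \<omega>)) - expectation (\<lambda>\<omega>. cts_step x y (X n \<omega>))\<bar>
          \<le> e / 2 + measure M (?A n)" for n
      proof -
        let ?D = "\<lambda>\<omega>. cts_step x y (Y n \<omega>) - cts_step x y (X n \<omega>)"
        \<comment> \<open>On \<open>?A n\<close> the two ramp values lie in the unit interval and
          differ by at most 1; elsewhere the Lipschitz bound applies.\<close>
        have "\<bar>expectation ?D\<bar> \<le> expectation (\<lambda>\<omega>. e / 2 + indicator (?A n) \<omega>)"
        proof (rule order_trans[OF integral_abs_bound integral_mono])
          fix \<omega> assume w: "\<omega> \<in> space M"
          show "\<bar>?D \<omega>\<bar> \<le> e / 2 + indicator (?A n) \<omega>"
          proof (cases "\<omega> \<in> ?A n")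
            case True
            then have "indicator (?A n) \<omega> = (1::real)" by simp
            then show ?thesis using unit[of "Y n \<omega>"] unit[of "X n \<omega>"] e by linarith
          next
            case False
            have "\<bar>Y n \<omega> - X n \<omega>\<bar> / (y - x) \<le> d / (y - x)"
              using False w xy by (intro divide_right_mono) auto
            also have "d / (y - x) = e / 2" unfolding d_def by (rule nonzero_mult_div_cancel_right) (use xy in simp)
            finally have "\<bar>?D \<omega>\<bar> \<le> e / 2"
              using cts_step_Lipschitz[OF xy] order_trans by blast
            then show ?thesis using False by simp
          qed
        next
          show "integrable M (\<lambda>\<omega>. \<bar>?D \<omega>\<bar>)"
            by (intro integrable_abs Bochner_Integration.integrable_diff int) measurable
          show "integrable M (\<lambda>\<omega>. e / 2 + indicator (?A n) \<omega> :: real)"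
            by (intro Bochner_Integration.integrable_add integrable_const integrable_real_indicator)
              (auto simp: emeasure_eq_measure)
        qed
        moreover have "expectation ?D = expectation (\<lambda>\<omega>. cts_step x y (Y n \<omega>)) - expectation (\<lambda>\<omega>. cts_step x y (X n \<omega>))"
          by (intro Bochner_Integration.integral_diff int) measurable
        moreover have "expectation (\<lambda>\<omega>. e / 2 + indicator (?A n) \<omega>) = e / 2 + measure M (?A n)"
          by (subst Bochner_Integration.integral_add) (auto simp: prob_space emeasure_eq_measure)
        ultimately show ?thesis by simp
      qed
      have "(\<lambda>n. measure M (?A n)) \<longlonglongrightarrow> 0"
        using converges_in_probD[OF diff d] by simp
      then have "eventually (\<lambda>n. measure M (?A n) < e / 2) sequentially"
        using e by (intro order_tendstoD(2)) auto
      then show "eventually (\<lambda>n. dist (expectation (\<lambda>\<omega>. cts_step x y (Y n \<omega>)) - expectation (\<lambda>\<omega>. cts_step x y (X n \<omega>))) 0 < e) sequentially"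
      proof eventually_elim
        case (elim n)
        then show ?case using bound[of n] by (simp add: dist_real_def)
      qed
    qed
    from tendsto_add[OF this lim]
    show "(\<lambda>n. integral\<^sup>L (distr M borel (Y n)) (cts_step x y)) \<longlonglongrightarrow> integral\<^sup>L N (cts_step x y)"
      by (simp add: integral_distr)
  qed
qed

text \<open>Uniformly bounded second moments make \<open>X n\<close> tight by Chebyshev, so a factor
  tending to 0 in probability drags the product to 0.\<close>

lemma converges_in_prob_mult_bounded:
  assumes [measurable]: "\<And>n. X n \<in> borel_measurable M" "\<And>n. R n \<in> borel_measurable M"
    and int: "\<And>n. integrable M (\<lambda>\<omega>. (X n \<omega>)\<^sup>2)"
    and bd: "\<And>n. expectation (\<lambda>\<omega>. (X n \<omega>)\<^sup>2) \<le> B"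
    and R: "converges_in_prob M R 0"
  shows "converges_in_prob M (\<lambda>n \<omega>. X n \<omega> * R n \<omega>) 0"
  unfolding converges_in_prob_def
proof (intro allI impI)
  fix e :: real assume e: "e > 0"
  have "0 \<le> expectation (\<lambda>\<omega>. (X 0 \<omega>)\<^sup>2)" by simp
  then have B: "B \<ge> 0" using bd[of 0] by linarith
  show "(\<lambda>n. measure M {\<omega>\<in>space M. e < \<bar>X n \<omega> * R n \<omega> - 0\<bar>}) \<longlonglongrightarrow> 0"
  proof (rule tendstoI)
    fix d :: real assume d: "d > 0"
    \<comment> \<open>This cutoff makes the Chebyshev bound \<open>B / K\<^sup>2\<close> smaller
      than \<open>d / 2\<close>; using \<open>B + 1\<close> keeps \<open>K\<close> positive and the
      inequality strict even for \<open>B = 0\<close>.\<close>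
    define K where "K = sqrt (2 * (B + 1) / d)"
    have K: "K > 0" unfolding K_def using B d by (intro real_sqrt_gt_zero divide_pos_pos) auto
    have K2: "K\<^sup>2 = 2 * (B + 1) / d" unfolding K_def using B d by (intro real_sqrt_pow2 divide_nonneg_pos) auto
    have "B / K\<^sup>2 = (B / (B + 1)) * (d / 2)" unfolding K2 by simp
    also have "\<dots> < 1 * (d / 2)" using B d by (intro mult_strict_right_mono) auto
    finally have BK: "B / K\<^sup>2 < d / 2" by simp
    let ?A = "\<lambda>n. {\<omega>\<in>space M. K \<le> \<bar>X n \<omega>\<bar>}" and ?B = "\<lambda>n. {\<omega>\<in>space M. e / K < \<bar>R n \<omega>\<bar>}"
    have bound: "measure M {\<omega>\<in>space M. e < \<bar>X n \<omega> * R n \<omega> - 0\<bar>} \<le> B / K\<^sup>2 + measure M (?B n)" for n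
    proof -
      have "\<bar>X n \<omega> * R n \<omega>\<bar> \<le> e" if "\<bar>X n \<omega>\<bar> < K" "\<bar>R n \<omega>\<bar> \<le> e / K" for \<omega>
        using mult_mono[of "\<bar>X n \<omega>\<bar>" K "\<bar>R n \<omega>\<bar>" "e / K"] that K by (simp add: abs_mult)
      then have "{\<omega>\<in>space M. e < \<bar>X n \<omega> * R n \<omega> - 0\<bar>} \<subseteq> ?A n \<union> ?B n"
        by (auto simp: not_le not_less) (meson linorder_not_less)
      then have "measure M {\<omega>\<in>space M. e < \<bar>X n \<omega> * R n \<omega> - 0\<bar>} \<le> measure M (?A n \<union> ?B n)"
        by (intro finite_measure_mono) auto
      also have "\<dots> \<le> measure M (?A n) + measure M (?B n)"
        by (intro measure_Un_le) auto
      also have "measure M (?A n) \<le> expectation (\<lambda>\<omega>. (X n \<omega>)\<^sup>2) / K\<^sup>2"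
        by (rule second_moment_method) (use K int in auto)
      also have "\<dots> \<le> B / K\<^sup>2" using bd by (intro divide_right_mono) auto
      finally show ?thesis by simp
    qed
    have "(\<lambda>n. measure M (?B n)) \<longlonglongrightarrow> 0"
      using converges_in_probD[OF R divide_pos_pos[OF e K]] by simp
    then have "eventually (\<lambda>n. measure M (?B n) < d / 2) sequentially"
      using d by (intro order_tendstoD(2)) auto
    then show "eventually (\<lambda>n. dist (measure M {\<omega>\<in>space M. e < \<bar>X n \<omega> * R n \<omega> - 0\<bar>}) 0 < d) sequentially"
    proof eventually_elim
      case (elim n)
      have "measure M {\<omega>\<in>space M. e < \<bar>X n \<omega> * R n \<omega> - 0\<bar>} < d"
        using bound[of n] BK elim by linarith
      then show ?case by (simp add: dist_real_def)
    qed
  qed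
qed

end

section \<open>Fourth moments and studentization\<close>

text \<open>The inequality \<open>(a + b)\<^sup>2 \<le> 2 * a\<^sup>2 + 2 * b\<^sup>2\<close> is
  applied twice.\<close>

lemma power4_add_le: "(x + y) ^ 4 \<le> 8 * x ^ 4 + 8 * (y :: real) ^ 4"
proof -
  have "(x + y)\<^sup>2 \<le> 2 * x\<^sup>2 + 2 * y\<^sup>2"
    using zero_le_power2[of "x - y"] by (simp add: power2_eq_square algebra_simps)
  then have "((x + y)\<^sup>2)\<^sup>2 \<le> (2 * x\<^sup>2 + 2 * y\<^sup>2)\<^sup>2" by (intro power_mono) auto
  also have "\<dots> \<le> 8 * (x\<^sup>2)\<^sup>2 + 8 * (y\<^sup>2)\<^sup>2"
    using zero_le_power2[of "x\<^sup>2 - y\<^sup>2"] by (simp add: power2_sum power2_diff power_mult_distrib)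
  finally show ?thesis by (simp flip: power_mult)
qed

text \<open>Allows finiteness of a fourth moment to be checked summand by summand.\<close>

lemma integrable_power4_add:
  fixes f g :: "'a \<Rightarrow> real"
  assumes [measurable]: "f \<in> borel_measurable M" "g \<in> borel_measurable M"
    and "integrable M (\<lambda>x. f x ^ 4)" "integrable M (\<lambda>x. g x ^ 4)"
  shows "integrable M (\<lambda>x. (f x + g x) ^ 4)"
proof (rule Bochner_Integration.integrable_bound)
  show "integrable M (\<lambda>x. 8 * f x ^ 4 + 8 * g x ^ 4)" using assms by simp
  show "AE x in M. norm ((f x + g x) ^ 4) \<le> norm (8 * f x ^ 4 + 8 * g x ^ 4)"
    by (intro AE_I2) (use power4_add_le in simp)
qed measurable

text \<open>The statistic factors as \<open>A n * R n\<close>: the sum normalised by the true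
  standard deviation, times the ratio of true to sample standard deviation. The first factor obeys
  the central limit theorem and the second tends to 1; fourth moments give the weak law for the
  squares.\<close>

lemma (in prob_space) studentized_central_limit_theorem:
  fixes Y :: "nat \<Rightarrow> 'a \<Rightarrow> real"
  assumes indep: "indep_vars (\<lambda>_. borel) Y UNIV"
    and dist: "\<And>i. distr M borel (Y i) = D"
    and int4: "\<And>i. integrable M (\<lambda>\<omega>. (Y i \<omega>) ^ 4)"
    and mean: "\<And>i. expectation (Y i) = m"
    and s: "s > 0" and var: "\<And>i. variance (Y i) = s\<^sup>2"
  shows "weak_conv_m (\<lambda>n. distr M borel (\<lambda>\<omega>. gev_T n m (\<lambda>i. Y i \<omega>))) std_normal_distribution"
proof -
  have rv[measurable]: "Y i \<in> borel_measurable M" for i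
    using indep by (auto simp: indep_vars_def)
  have sqY: "integrable M (\<lambda>\<omega>. (Y i \<omega>)\<^sup>2)" for i
    by (rule square_integrable_imp_integrable) (use int4 in \<open>simp_all flip: power_mult\<close>)
  have intY: "integrable M (Y i)" for i
    using rv sqY by (rule square_integrable_imp_integrable)
  define Z where "Z i \<omega> = Y i \<omega> - m" for i \<omega>
  have rvZ[measurable]: "Z i \<in> borel_measurable M" for i
    by (simp add: Z_def[abs_def])
  have sqZ: "integrable M (\<lambda>\<omega>. (Z i \<omega>)\<^sup>2)" for i
    unfolding power2_diff Z_def by (intro Bochner_Integration.integrable_add Bochner_Integration.integrable_diff sqY
        integrable_mult_left integrable_mult_right intY integrable_const)
  have EZ: "expectation (Z i) = 0" for i
    using intY mean by (simp add: Z_def[abs_def] prob_space)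
  have EZ2: "expectation (\<lambda>\<omega>. (Z i \<omega>)\<^sup>2) = s\<^sup>2" for i
    using var[of i] by (simp add: mean Z_def)
  have indZ: "indep_vars (\<lambda>_. borel) Z UNIV"
    unfolding Z_def using indep by (rule indep_vars_compose2) auto
  have indZ2: "indep_vars (\<lambda>_. borel) (\<lambda>i \<omega>. (Z i \<omega>)\<^sup>2) UNIV"
    using indZ by (rule indep_vars_compose2) auto
  have Z4: "integrable M (\<lambda>\<omega>. ((Z i \<omega>)\<^sup>2)\<^sup>2)" for i
    using integrable_power4_add[OF rv borel_measurable_const int4 integrable_const, of i "- m"]
    by (simp add: Z_def flip: power_mult)
  \<comment> \<open>The variance of the square is an integral against the common law
    \<open>D\<close>, hence the same for every index.\<close>
  have distZ2: "variance (\<lambda>\<omega>. (Z i \<omega>)\<^sup>2) = variance (\<lambda>\<omega>. (Z 0 \<omega>)\<^sup>2)" for i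
  proof -
    have "variance (\<lambda>\<omega>. (Z i \<omega>)\<^sup>2) = (LINT y|D. (((y - m)\<^sup>2) - s\<^sup>2)\<^sup>2)" for i
      unfolding EZ2 dist[of i, symmetric] by (subst integral_distr) (auto simp: Z_def)
    then show ?thesis by simp
  qed
  \<comment> \<open>\<open>A\<close> has the form delivered by \<open>central_limit_theorem\<close>;
    \<open>a\<close> and \<open>V\<close> are the sample means of the centred variables and of their
    squares.\<close>
  define A where "A n \<omega> = (\<Sum>i<n. Z i \<omega>) / sqrt (real n * s\<^sup>2)" for n \<omega>
  define a where "a n \<omega> = (\<Sum>i<n. Z i \<omega>) / real n" for n \<omega>
  define V where "V n \<omega> = (\<Sum>i<n. (Z i \<omega>)\<^sup>2) / real n" for n \<omega>
  \<comment> \<open>The sample variance is \<open>real n / (real n - 1)\<close> times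
    \<open>V n \<omega> - (a n \<omega>)\<^sup>2\<close>, so this is \<open>s\<close> divided by its
    root.\<close>
  define R where "R n \<omega> = sqrt ((real n - 1) / real n) * (s / sqrt (V n \<omega> - (a n \<omega>)\<^sup>2))" for n \<omega>
  have [measurable]: "A n \<in> borel_measurable M" "a n \<in> borel_measurable M" "V n \<in> borel_measurable M" for n
    by (simp_all add: A_def[abs_def] a_def[abs_def] V_def[abs_def])
  then have [measurable]: "R n \<in> borel_measurable M" for n
    by (simp add: R_def[abs_def])
  have clt: "weak_conv_m (\<lambda>n. distr M borel (A n)) std_normal_distribution"
    using central_limit_theorem[OF indep mean s sqY var dist] unfolding A_def[abs_def] Z_def by simp
  have a: "converges_in_prob M a 0"
    unfolding a_def[abs_def]
    by (rule weak_law_of_large_numbers[OF indZ sqZ EZ, of "s\<^sup>2"]) (simp add: EZ EZ2)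
  have V: "converges_in_prob M V (s\<^sup>2)"
    unfolding V_def[abs_def]
    by (rule weak_law_of_large_numbers[OF indZ2 Z4 EZ2]) (rule eq_refl[OF distZ2])
  have "converges_in_prob M (\<lambda>n \<omega>. (\<lambda>v a. s / sqrt (v - a\<^sup>2)) (V n \<omega>) (a n \<omega>)) ((\<lambda>v a. s / sqrt (v - a\<^sup>2)) (s\<^sup>2) 0)"
  proof (rule converges_in_prob_continuous2[OF _ _ V a])
    show "isCont (\<lambda>p. s / sqrt (fst p - (snd p)\<^sup>2)) (s\<^sup>2, 0)"
      using s by (intro continuous_intros) auto
  qed simp_all
  then have f: "converges_in_prob M (\<lambda>n \<omega>. s / sqrt (V n \<omega> - (a n \<omega>)\<^sup>2)) 1"
    using s by simp
  have c: "(\<lambda>n. sqrt ((real n - 1) / real n)) \<longlonglongrightarrow> 1"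
  proof -
    have "(\<lambda>n. 1 - 1 / real n) \<longlonglongrightarrow> 1 - 0"
      by (intro tendsto_diff tendsto_const lim_1_over_n)
    then have "(\<lambda>n. sqrt (1 - 1 / real n)) \<longlonglongrightarrow> sqrt (1 - 0)"
      by (rule tendsto_real_sqrt)
    moreover have "eventually (\<lambda>n. sqrt (1 - 1 / real n) = sqrt ((real n - 1) / real n)) sequentially"
      using eventually_gt_at_top[of "0::nat"] by eventually_elim (simp add: diff_divide_distrib)
    ultimately show ?thesis by (simp add: tendsto_cong)
  qed
  \<comment> \<open>Subtracting 1 inside the continuous function yields the limit 0 directly, as the
    product lemma requires.\<close>
  have "converges_in_prob M (\<lambda>n \<omega>. (\<lambda>u v. u * v - 1) (sqrt ((real n - 1) / real n)) (s / sqrt (V n \<omega> - (a n \<omega>)\<^sup>2)))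
      ((\<lambda>u v. u * v - 1) 1 1)"
    by (rule converges_in_prob_continuous2[OF _ _ converges_in_prob_const[OF c] f])
      (auto intro!: continuous_intros)
  then have R: "converges_in_prob M (\<lambda>n \<omega>. R n \<omega> - 1) 0"
    by (simp add: R_def)
  have "indep_vars (\<lambda>_. borel) Z {..<n}" for n
    using indZ by (rule indep_vars_subset) auto
  then have sumZ: "integrable M (\<lambda>\<omega>. (\<Sum>i<n. Z i \<omega>)\<^sup>2)"
    "expectation (\<lambda>\<omega>. (\<Sum>i<n. Z i \<omega>)\<^sup>2) = real n * s\<^sup>2" for n
    using square_sum_indep_vars[of "{..<n}" Z] sqZ EZ EZ2 by auto
  have Asq: "(A n \<omega>)\<^sup>2 = (\<Sum>i<n. Z i \<omega>)\<^sup>2 / (real n * s\<^sup>2)" for n \<omega>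
    by (simp add: A_def power_divide power_mult_distrib)
  \<comment> \<open>The expectation is 1 for positive \<open>n\<close> but 0 for
    \<open>n = 0\<close>, hence an inequality.\<close>
  have A2: "integrable M (\<lambda>\<omega>. (A n \<omega>)\<^sup>2)" "expectation (\<lambda>\<omega>. (A n \<omega>)\<^sup>2) \<le> 1" for n
    unfolding Asq using sumZ[of n] by simp_all
  have T: "gev_T n m (\<lambda>i. Y i \<omega>) = A n \<omega> * R n \<omega>" for n \<omega>
  proof (cases "n \<le> 1")
    case True
    \<comment> \<open>Both sides are 0 here: for \<open>n = 0\<close> through the empty sum and
      \<open>sqrt 0\<close>, for \<open>n = 1\<close> because the factor \<open>real n - 1\<close>
      vanishes and division by zero gives 0.\<close>
    then have "n = 0 \<or> n = 1" by auto
    then show ?thesis by (auto simp: gev_T_def A_def R_def)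
  next
    case False
    then have n: "real n > 1" by simp
    have sumY: "(\<Sum>i<n. Y i \<omega>) / real n = m + a n \<omega>"
      using n by (simp add: a_def Z_def sum_subtractf field_simps)
    have "(\<Sum>i<n. (Y i \<omega> - (m + a n \<omega>))\<^sup>2) = (\<Sum>i<n. (Z i \<omega>)\<^sup>2 - 2 * a n \<omega> * Z i \<omega> + (a n \<omega>)\<^sup>2)"
      by (intro sum.cong) (auto simp: Z_def power2_eq_square algebra_simps)
    also have "\<dots> = (\<Sum>i<n. (Z i \<omega>)\<^sup>2) - 2 * a n \<omega> * (\<Sum>i<n. Z i \<omega>) + real n * (a n \<omega>)\<^sup>2"
      by (simp add: sum.distrib sum_subtractf sum_distrib_left)
    also have "(\<Sum>i<n. (Z i \<omega>)\<^sup>2) = real n * V n \<omega>" using n by (simp add: V_def)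
    also have "(\<Sum>i<n. Z i \<omega>) = real n * a n \<omega>" using n by (simp add: a_def)
    also have "real n * V n \<omega> - 2 * a n \<omega> * (real n * a n \<omega>) + real n * (a n \<omega>)\<^sup>2 = real n * (V n \<omega> - (a n \<omega>)\<^sup>2)"
      by (simp add: power2_eq_square algebra_simps)
    finally have S2: "(\<Sum>i<n. (Y i \<omega> - (m + a n \<omega>))\<^sup>2) = real n * (V n \<omega> - (a n \<omega>)\<^sup>2)" .
    have "A n \<omega> = sqrt (real n) * a n \<omega> / s"
    proof -
      have "A n \<omega> = (real n * a n \<omega>) / (sqrt (real n) * s)"
        using n s by (simp add: A_def a_def real_sqrt_mult)
      also have "\<dots> = (real n / sqrt (real n)) * a n \<omega> / s" by simp
      finally show ?thesis by (simp add: real_div_sqrt)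
    qed
    moreover have "gev_T n m (\<lambda>i. Y i \<omega>)
        = sqrt (real n) * a n \<omega> / sqrt (real n * (V n \<omega> - (a n \<omega>)\<^sup>2) / (real n - 1))"
      by (simp add: gev_T_def sumY S2)
    ultimately show ?thesis
      using s n by (simp add: R_def real_sqrt_mult real_sqrt_divide)
  qed
  show ?thesis
  proof (rule weak_conv_m_of_diff_converges_in_prob[OF _ _ _ clt])
    have "converges_in_prob M (\<lambda>n \<omega>. A n \<omega> * (R n \<omega> - 1)) 0"
      by (rule converges_in_prob_mult_bounded[OF _ _ A2 R]) simp_all
    then show "converges_in_prob M (\<lambda>n \<omega>. gev_T n m (\<lambda>i. Y i \<omega>) - A n \<omega>) 0"
      by (simp add: T right_diff_distrib)
    show "real_distribution std_normal_distribution" by (rule real_dist_normal_dist)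
  qed (simp_all add: T)
qed

section \<open>Moments of the Erlang distribution\<close>

text \<open>For \<open>k = 0\<close> the density is positive at 0, so that single point is discarded
  as a Lebesgue null set. Positivity then justifies the rules for \<open>ln\<close> and
  \<open>powr\<close>.\<close>

lemma AE_erlang_pos: "AE u in density lborel (\<lambda>u. ennreal (erlang_density k 1 u)). u > 0"
proof -
  have "AE u in lborel. ennreal (erlang_density k 1 u) > 0 \<longrightarrow> u > 0"
    using AE_lborel_singleton[of 0] by eventually_elim (auto simp: erlang_density_def split: if_splits)
  then show ?thesis by (simp add: AE_density)
qed

text \<open>This is the Gamma integral; \<open>erlang_density k\<close> has shape
  \<open>k + 1\<close>. Negative exponents are included because the lower bound for
  \<open>ln\<close> uses them.\<close>

lemma has_bochner_integral_erlang_powr: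
  assumes "s > - real (Suc k)"
  shows "has_bochner_integral (density lborel (\<lambda>u. ennreal (erlang_density k 1 u)))
    (\<lambda>u. u powr s) (Gamma (real (Suc k) + s) / fact k)"
proof (rule has_bochner_integral_nn_integral)
  show "0 \<le> Gamma (real (Suc k) + s) / fact k"
    using assms by (intro divide_nonneg_pos less_imp_le[OF Gamma_real_pos]) auto
  have "(\<integral>\<^sup>+u. ennreal (u powr s) \<partial>density lborel (\<lambda>u. ennreal (erlang_density k 1 u)))
      = (\<integral>\<^sup>+u. ennreal (erlang_density k 1 u) * ennreal (u powr s) \<partial>lborel)"
    by (simp add: nn_integral_density)
  also have "\<dots> = (\<integral>\<^sup>+u. ennreal (1 / fact k) *
      ennreal (indicator {0..} u * u powr ((real (Suc k) + s) - 1) / exp u) \<partial>lborel)"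
  proof (rule nn_integral_cong_AE)
    show "AE u in lborel. ennreal (erlang_density k 1 u) * ennreal (u powr s) = ennreal (1 / fact k) *
      ennreal (indicator {0..} u * u powr ((real (Suc k) + s) - 1) / exp u)"
      using AE_lborel_singleton[of 0]
    proof eventually_elim
      case (elim u)
      show ?case
      proof (cases "u < 0")
        case True
        then show ?thesis by (simp add: erlang_density_def)
      next
        case False
        then have u: "u > 0" using elim by simp
        have "u powr ((real (Suc k) + s) - 1) = u ^ k * u powr s"
          using u by (simp add: powr_realpow[symmetric] flip: powr_add)
        then show ?thesis
          using u by (simp add: erlang_density_def exp_minus field_simps flip: ennreal_mult)
      qed
    qed
  qed
  also have "\<dots> = ennreal (1 / fact k) * ennreal (Gamma (real (Suc k) + s))"
    using assms by (subst nn_integral_cmult) (simp_all add: Gamma_conv_nn_integral_real)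
  finally show "(\<integral>\<^sup>+u. ennreal (u powr s) \<partial>density lborel (\<lambda>u. ennreal (erlang_density k 1 u)))
      = ennreal (Gamma (real (Suc k) + s) / fact k)"
    using assms by (simp add: Gamma_real_pos less_imp_le flip: ennreal_mult)
qed simp_all

lemma has_bochner_integral_erlang_id:
  "has_bochner_integral (density lborel (\<lambda>u. ennreal (erlang_density k 1 u))) (\<lambda>u. u) (real (Suc k))"
proof -
  have "has_bochner_integral (density lborel (\<lambda>u. ennreal (erlang_density k 1 u)))
      (\<lambda>u. u powr 1) (Gamma (real (Suc k) + 1) / fact k)"
    by (rule has_bochner_integral_erlang_powr) simp
  also have "Gamma (real (Suc k) + 1) / fact k = real (Suc k)"
    using Gamma_fact[of "Suc k", where 'a = real] by (simp add: add_ac)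
  finally show ?thesis
    by (rule has_bochner_integral_cong_AE[THEN iffD1, rotated -1])
      (use AE_erlang_pos[of k] in \<open>auto elim: eventually_mono\<close>)
qed

lemma integrable_erlang_power:
  "integrable (density lborel (\<lambda>u. ennreal (erlang_density k 1 u))) (\<lambda>u. u ^ m)"
proof -
  have "integrable (density lborel (\<lambda>u. ennreal (erlang_density k 1 u))) (\<lambda>u. u powr real m)"
    using has_bochner_integral_erlang_powr[of k "real m"] by (auto simp: has_bochner_integral_iff)
  moreover have "AE u in density lborel (\<lambda>u. ennreal (erlang_density k 1 u)). u powr real m = u ^ m"
    using AE_erlang_pos by eventually_elim (simp add: powr_realpow)
  ultimately show ?thesis
    by (subst (asm) integrable_cong_AE) auto
qed

text \<open>Both bounds are \<open>ln y \<le> y - 1\<close>, taken at \<open>u powr t\<close> and at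
  its reciprocal.\<close>

lemma ln_powr_bounds:
  fixes u t :: real
  assumes "u > 0" "t > 0"
  shows "ln u \<le> (u powr t - 1) / t" "(1 - u powr (- t)) / t \<le> ln u"
proof -
  have "t * ln u \<le> u powr t - 1" "- t * ln u \<le> u powr (- t) - 1"
    using ln_le_minus_one[of "u powr t"] ln_le_minus_one[of "u powr (- t)"] assms by (auto simp: ln_powr)
  then show "ln u \<le> (u powr t - 1) / t" "(1 - u powr (- t)) / t \<le> ln u"
    using assms by (auto simp: field_simps)
qed

text \<open>The logarithm is dominated by powers with exponents \<open>1 / 8\<close> and
  \<open>- 1 / 8\<close>. Their fourth powers have exponents \<open>1 / 2\<close> and
  \<open>- 1 / 2\<close>, which are integrable for every shape, including
  \<open>k = 0\<close>.\<close>

lemma integrable_erlang_ln_power4: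
  "integrable (density lborel (\<lambda>u. ennreal (erlang_density k 1 u))) (\<lambda>u. ln u ^ 4)"
proof (rule Bochner_Integration.integrable_bound)
  let ?D = "density lborel (\<lambda>u. ennreal (erlang_density k 1 u))"
  have "integrable ?D (\<lambda>u. (8 * (u powr (1 / 8) + u powr (- 1 / 8))) ^ 4)"
    unfolding power_mult_distrib
  proof (intro integrable_mult_right integrable_power4_add)
    have "integrable ?D (\<lambda>u. (u powr s) ^ 4)" if "4 * s > -1" for s
    proof -
      have "integrable ?D (\<lambda>u. u powr (4 * s))"
        using has_bochner_integral_erlang_powr[of k "4 * s"] that by (auto simp: has_bochner_integral_iff)
      moreover have "(u powr s) ^ 4 = u powr (4 * s)" for u :: real
        using exp_of_nat_mult[of 4 "s * ln u"] by (simp add: powr_def mult.assoc)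
      ultimately show ?thesis by simp
    qed
    from this[of "1/8"] this[of "-1/8"]
    show "integrable ?D (\<lambda>u. (u powr (1 / 8)) ^ 4)" "integrable ?D (\<lambda>u. (u powr (- 1 / 8)) ^ 4)"
      by simp_all
  qed measurable
  then show "integrable ?D (\<lambda>u. (8 * (u powr (1 / 8) + u powr (- 1 / 8))) ^ 4)" .
  show "AE u in ?D. norm (ln u ^ 4) \<le> norm ((8 * (u powr (1 / 8) + u powr (- 1 / 8))) ^ 4)"
    using AE_erlang_pos
  proof eventually_elim
    case (elim u)
    have "ln u \<le> 8 * u powr (1 / 8)" "- ln u \<le> 8 * u powr (- 1 / 8)"
      using ln_powr_bounds[OF elim, of "1/8"] by simp_all
    moreover have "u powr (1 / 8) \<ge> 0" "u powr (- 1 / 8) \<ge> 0" by simp_all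
    ultimately have "\<bar>ln u\<bar> \<le> 8 * (u powr (1 / 8) + u powr (- 1 / 8))"
      unfolding distrib_left by linarith
    then have "\<bar>ln u\<bar> ^ 4 \<le> (8 * (u powr (1 / 8) + u powr (- 1 / 8))) ^ 4" by (rule power_mono) simp
    then show ?case by simp
  qed
qed measurable

text \<open>The bounds \<^term>\<open>(1 - u powr (- t)) / t \<le> ln u \<and> ln u \<le> (u powr t - 1) / t\<close> turn into difference
  quotients of the Gamma function after integration, so no differentiation under the integral sign is needed.\<close>

lemma has_bochner_integral_erlang_ln:
  "has_bochner_integral (density lborel (\<lambda>u. ennreal (erlang_density k 1 u))) ln (Digamma (real (Suc k)))"
proof -
  let ?D = "density lborel (\<lambda>u. ennreal (erlang_density k 1 u))"
  interpret prob_space ?D by (rule prob_space_erlang_density) simp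
  have sq: "integrable ?D (\<lambda>u. (ln u)\<^sup>2)"
    by (rule square_integrable_imp_integrable) (use integrable_erlang_ln_power4 in \<open>simp_all flip: power_mult\<close>)
  have int: "integrable ?D ln"
    by (rule square_integrable_imp_integrable[OF _ sq]) simp
  \<comment> \<open>The moment function of the law; its derivative at 0 is the logarithmic
    derivative of \<open>Gamma\<close> at \<open>Suc k\<close>, since
    \<open>Gamma (real (Suc k)) = fact k\<close>.\<close>
  define G where "G t = Gamma (real (Suc k) + t) / fact k" for t
  have G: "has_bochner_integral ?D (\<lambda>u. u powr t) (G t)" if "t > - 1" for t
    unfolding G_def using that by (intro has_bochner_integral_erlang_powr) simp
  have Gk: "Gamma (real (Suc k)) = fact k"
    using Gamma_fact[of k, where 'a = real] by (simp add: add_ac)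
  have G0: "G 0 = 1" by (simp add: G_def Gk del: of_nat_Suc)
  have npos: "real (Suc k) + 0 \<notin> \<int>\<^sub>\<le>\<^sub>0" by (auto elim!: nonpos_Ints_cases)
  have dG: "(G has_field_derivative Digamma (real (Suc k))) (at 0)"
    unfolding G_def[abs_def] using npos by (auto intro!: derivative_eq_intros simp: Gk simp del: of_nat_Suc)
  have dG': "((\<lambda>t. G (- t)) has_field_derivative - Digamma (real (Suc k))) (at 0)"
    by (rule DERIV_chain2[of G, where g = uminus, THEN DERIV_cong]) (auto intro!: derivative_eq_intros dG)
  have up: "((\<lambda>t. (G t - 1) / t) \<longlongrightarrow> Digamma (real (Suc k))) (at_right 0)"
    using dG by (auto simp: DERIV_def G0 intro: filterlim_mono[OF _ order_refl at_le])
  have "((\<lambda>t. (G (- t) - 1) / t) \<longlongrightarrow> - Digamma (real (Suc k))) (at_right 0)"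
    using dG' by (auto simp: DERIV_def G0 intro: filterlim_mono[OF _ order_refl at_le])
  from tendsto_minus[OF this] have lo: "((\<lambda>t. (1 - G (- t)) / t) \<longlongrightarrow> Digamma (real (Suc k))) (at_right 0)"
    by (simp add: minus_divide_left)
  have ev: "eventually (\<lambda>t::real. 0 < t \<and> t < 1) (at_right 0)"
    unfolding eventually_at_right_field by (intro exI[of _ 1]) auto
  \<comment> \<open>The restriction \<open>t < 1\<close> keeps the exponent \<open>- t\<close> in
    the range where the moment is finite for every \<open>k\<close>.\<close>
  have bounds: "(1 - G (- t)) / t \<le> expectation ln \<and> expectation ln \<le> (G t - 1) / t" if t: "0 < t" "t < 1" for t
  proof
    have p: "integrable ?D (\<lambda>u. u powr t)" "expectation (\<lambda>u. u powr t) = G t"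
      and n: "integrable ?D (\<lambda>u. u powr (- t))" "expectation (\<lambda>u. u powr (- t)) = G (- t)"
      using G[of t] G[of "- t"] t by (auto simp: has_bochner_integral_iff)
    have "expectation ln \<le> expectation (\<lambda>u. (u powr t - 1) / t)"
      using AE_erlang_pos[of k] int p t ln_powr_bounds(1)[OF _ t(1)]
      by (intro integral_mono_AE) (auto elim: eventually_mono)
    then show "expectation ln \<le> (G t - 1) / t" using p by (simp add: prob_space[simplified])
    have "expectation (\<lambda>u. (1 - u powr (- t)) / t) \<le> expectation ln"
      using AE_erlang_pos[of k] int n t ln_powr_bounds(2)[OF _ t(1)]
      by (intro integral_mono_AE) (auto elim: eventually_mono)
    then show "(1 - G (- t)) / t \<le> expectation ln" using n by (simp add: prob_space[simplified])
  qed
  have "Digamma (real (Suc k)) \<le> expectation ln"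
    by (rule tendsto_upperbound[OF lo]) (use ev bounds in \<open>auto elim: eventually_mono\<close>)
  moreover have "expectation ln \<le> Digamma (real (Suc k))"
    by (rule tendsto_lowerbound[OF up]) (use ev bounds in \<open>auto elim: eventually_mono\<close>)
  ultimately show ?thesis using int by (simp add: has_bochner_integral_iff)
qed

section \<open>The largest order statistics\<close>

text \<open>The inner integral of the induction over order statistics: it turns the simplex volume
  of dimension \<open>k\<close> into that of dimension \<open>Suc k\<close>.\<close>

lemma nn_integral_power_half_open:
  assumes "w \<ge> 0"
  shows "(\<integral>\<^sup>+u. indicator {0<..} u * (ennreal (u ^ k / fact k) * indicator {..<w} u) \<partial>lborel)
    = ennreal (w ^ Suc k / fact (Suc k))"
proof -
  have "(\<integral>\<^sup>+u. indicator {0<..} u * (ennreal (u ^ k / fact k) * indicator {..<w} u) \<partial>lborel)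
      = (\<integral>\<^sup>+u. ennreal (u ^ k / fact k) * indicator {0..w} u \<partial>lborel)"
    by (rule nn_integral_cong_AE)
      (use AE_lborel_singleton[of 0] AE_lborel_singleton[of w] in eventually_elim, auto simp: indicator_def)
  also have "\<dots> = ennreal (w ^ Suc k / fact (Suc k) - 0 ^ Suc k / fact (Suc k))"
  proof (rule nn_integral_FTC_Icc[where F = "\<lambda>u. u ^ Suc k / fact (Suc k)"])
    fix u :: real assume "u \<in> {0..w}"
    have "((\<lambda>u. u ^ Suc k / fact (Suc k)) has_real_derivative real (Suc k) * u ^ k / fact (Suc k)) (at u)"
      by (auto intro!: derivative_eq_intros simp del: fact_Suc power_Suc)
    moreover have "real (Suc k) * u ^ k / fact (Suc k) = u ^ k / fact k"
      by (simp del: of_nat_Suc)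
    ultimately show "((\<lambda>u. u ^ Suc k / fact (Suc k)) has_real_derivative u ^ k / fact k) (at u)"
      by simp
  qed (use assms in auto)
  finally show ?thesis by simp
qed

section \<open>The coordinate change from GEV variables to Poisson points\<close>

locale gev =
  fixes \<mu> \<sigma> \<xi> :: real
  assumes sigma_pos: "\<sigma> > 0"
begin

definition supp :: "real set" where
  "supp = {x. 1 + \<xi> * gev_z \<mu> \<sigma> x > 0}"

definition U :: "real \<Rightarrow> real" where
  "U x = (if \<xi> = 0 then exp (- gev_z \<mu> \<sigma> x) else (1 + \<xi> * gev_z \<mu> \<sigma> x) powr (- 1 / \<xi>))"

text \<open>The inverse of \<open>U\<close>, mapping the positive half-line onto
  \<open>supp\<close>.\<close>

definition V :: "real \<Rightarrow> real" where
  "V u = \<mu> + \<sigma> * (if \<xi> = 0 then - ln u else (u powr (- \<xi>) - 1) / \<xi>)"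

text \<open>Also the factor that each coordinate contributes to \<open>gevr_density\<close>; the
  remaining factor is the exponential of minus \<open>U\<close> at the last coordinate.\<close>

definition h :: "real \<Rightarrow> real" where
  "h x = indicator supp x * (U x powr (1 + \<xi>) / \<sigma>)"

lemma measurable_gev [measurable]:
  "supp \<in> sets borel" "U \<in> borel_measurable borel" "h \<in> borel_measurable borel"
proof -
  show [measurable]: "supp \<in> sets borel"
    unfolding supp_def gev_z_def by measurable
  show [measurable]: "U \<in> borel_measurable borel"
    unfolding U_def[abs_def] gev_z_def by measurable
  show "h \<in> borel_measurable borel"
    unfolding h_def[abs_def] by measurable
qed

lemma h_nonneg: "h x \<ge> 0"
  using sigma_pos by (simp add: h_def)

lemma ln_U: "ln (U x) = (if \<xi> = 0 then - gev_z \<mu> \<sigma> x else - (1 / \<xi>) * ln (1 + \<xi> * gev_z \<mu> \<sigma> x))"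
  by (auto simp: U_def ln_powr)

lemma U_pos: "x \<in> supp \<Longrightarrow> U x > 0"
  by (auto simp: U_def supp_def)

lemma U_nonneg: "U x \<ge> 0"
  by (auto simp: U_def)

lemma V_supp: "u > 0 \<Longrightarrow> V u \<in> supp"
  using sigma_pos by (simp add: V_def supp_def gev_z_def)

lemma U_V: "u > 0 \<Longrightarrow> U (V u) = u"
  using sigma_pos by (simp add: V_def U_def gev_z_def powr_powr)

lemma V_U: "x \<in> supp \<Longrightarrow> V (U x) = x"
  using sigma_pos by (simp add: V_def U_def gev_z_def powr_powr supp_def)

text \<open>The Jacobian of the substitution; for positive \<open>u\<close> it equals
  \<open>- 1 / h (V u)\<close>.\<close>

lemma V_deriv:
  assumes "u > 0"
  shows "(V has_field_derivative - \<sigma> * u powr (- \<xi> - 1)) (at u within S)"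
proof (cases "\<xi> = 0")
  case True
  then show ?thesis
    unfolding V_def[abs_def] using assms
    by (auto intro!: derivative_eq_intros simp: powr_minus divide_simps)
next
  case False
  then show ?thesis
    unfolding V_def[abs_def] using assms
    by (auto intro!: derivative_eq_intros simp: field_simps)
qed

text \<open>Compared through \<open>ln_U\<close>: for negative \<open>\<xi>\<close> both the inner
  logarithm and the coefficient \<open>- (1 / \<xi>)\<close> change direction, so the order is
  reversed for every sign of \<open>\<xi>\<close>.\<close>

lemma U_strict_antimono:
  assumes "x \<in> supp" "y \<in> supp"
  shows "x < y \<longleftrightarrow> U y < U x"
proof -
  have *: "U y < U x" if "x \<in> supp" "y \<in> supp" "x < y" for x y
  proof -
    have "gev_z \<mu> \<sigma> x < gev_z \<mu> \<sigma> y"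
      using that sigma_pos by (simp add: gev_z_def divide_strict_right_mono)
    then have "ln (U y) < ln (U x)"
      using that unfolding ln_U supp_def by (cases "\<xi> = 0"; cases "\<xi> > 0") (auto simp: divide_strict_right_mono divide_strict_right_mono_neg)
    then show ?thesis using that U_pos by simp
  qed
  show ?thesis
    using *[OF assms] *[OF assms(2,1)] by (metis less_irrefl less_linear less_trans)
qed

text \<open>Since \<^term>\<open>h\<close> is minus the derivative of \<^term>\<open>U\<close> on its support, \<^term>\<open>U\<close> carries the measure with density
  \<^term>\<open>h\<close> to Lebesgue measure on the half-line.\<close>

lemma distr_U:
  "distr (density lborel (\<lambda>x. ennreal (h x))) borel U = density lborel (indicator {0<..})"
proof -
  \<comment> \<open>Reflecting makes the upper tails \<open>{a<..}\<close> finite, as the uniqueness rule for measures needs.\<close>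
  have *: "distr (density lborel (\<lambda>x. ennreal (h x))) borel (\<lambda>x. - U x) = density lborel (indicator {..<0})"
  proof (rule measure_eqI_lessThan)
    fix a :: real
    let ?S = "{0<..<-a}"
    have img: "V ` ?S = {x \<in> supp. U x < - a}"
    proof (intro set_eqI iffI)
      fix x assume "x \<in> V ` ?S"
      then show "x \<in> {x \<in> supp. U x < - a}" using V_supp U_V by auto
    next
      fix x assume "x \<in> {x \<in> supp. U x < - a}"
      then show "x \<in> V ` ?S" using U_pos V_U by (intro image_eqI[of _ _ "U x"]) auto
    qed
    have inj: "inj_on V ?S"
      by (intro inj_on_inverseI[of _ U]) (simp add: U_V)
    have der: "(V has_field_derivative - \<sigma> * u powr (- \<xi> - 1)) (at u within ?S)" if "u \<in> ?S" for u
      using that by (intro V_deriv) simp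
    \<comment> \<open>The Jacobian cancels the density, which is why Lebesgue measure
      results.\<close>
    have one: "\<bar>- \<sigma> * u powr (- \<xi> - 1)\<bar> * h (V u) = 1" if "u \<in> ?S" for u
      using that sigma_pos V_supp[of u] U_V[of u] by (simp add: h_def abs_mult flip: powr_add)
    have "(\<lambda>u. \<bar>- \<sigma> * u powr (- \<xi> - 1)\<bar> * h (V u)) absolutely_integrable_on ?S \<and>
        integral ?S (\<lambda>u. \<bar>- \<sigma> * u powr (- \<xi> - 1)\<bar> * h (V u)) = measure lborel ?S"
    proof
      have "(\<lambda>u. 1 :: real) absolutely_integrable_on ?S"
        by (intro absolutely_integrable_on_const) simp
      then show "(\<lambda>u. \<bar>- \<sigma> * u powr (- \<xi> - 1)\<bar> * h (V u)) absolutely_integrable_on ?S"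
        by (subst set_integrable_cong[OF refl refl one]) auto
      have "integral ?S (\<lambda>u. \<bar>- \<sigma> * u powr (- \<xi> - 1)\<bar> * h (V u)) = integral ?S (\<lambda>u. 1)"
        by (rule Henstock_Kurzweil_Integration.integral_cong) (rule one)
      also have "\<dots> = measure lebesgue ?S" by (rule lmeasure_integral[symmetric]) simp
      finally show "integral ?S (\<lambda>u. \<bar>- \<sigma> * u powr (- \<xi> - 1)\<bar> * h (V u)) = measure lborel ?S"
        by simp
    qed
    then have "h absolutely_integrable_on (V ` ?S) \<and> integral (V ` ?S) h = measure lborel ?S"
      by (subst (asm) has_absolute_integral_change_of_variables_1'[OF _ der inj]) simp_all
    then have "(h has_integral measure lborel ?S) (V ` ?S)"
      using set_lebesgue_integral_eq_integral(1) integrable_integral by metis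
    then have "(\<integral>\<^sup>+x. ennreal (h x) * indicator (V ` ?S) x \<partial>lborel) = measure lborel ?S"
      using h_nonneg by (intro nn_integral_has_integral_lebesgue') auto
    also have "measure lborel ?S = emeasure lborel ?S"
      by (intro emeasure_eq_ennreal_measure[symmetric]) (cases "a < 0"; simp)
    finally have I: "(\<integral>\<^sup>+x. ennreal (h x) * indicator (V ` ?S) x \<partial>lborel) = emeasure lborel ?S" .
    have [measurable]: "(\<lambda>x. - U x) -` {a<..} \<in> sets borel"
      using measurable_sets[of "\<lambda>x. - U x" borel borel "{a<..}"] by simp
    have "emeasure (distr (density lborel (\<lambda>x. ennreal (h x))) borel (\<lambda>x. - U x)) {a<..}
        = (\<integral>\<^sup>+x. ennreal (h x) * indicator ((\<lambda>x. - U x) -` {a<..}) x \<partial>lborel)"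
      by (simp add: emeasure_distr emeasure_density)
    \<comment> \<open>The preimage may contain points outside \<open>supp\<close>, but
      \<open>h\<close> vanishes there.\<close>
    also have "\<dots> = (\<integral>\<^sup>+x. ennreal (h x) * indicator (V ` ?S) x \<partial>lborel)"
      unfolding img by (intro nn_integral_cong) (auto simp: h_def indicator_def)
    finally have L: "emeasure (distr (density lborel (\<lambda>x. ennreal (h x))) borel (\<lambda>x. - U x)) {a<..}
        = emeasure lborel ?S" using I by simp
    have "emeasure (density lborel (indicator {..<0})) {a<..} = emeasure lborel {a<..<0}"
    proof -
      have "emeasure (density lborel (indicator {..<0})) {a<..} = (\<integral>\<^sup>+u. indicator {..<0} u * indicator {a<..} u \<partial>lborel)"
        by (rule emeasure_density) simp_all
      also have "\<dots> = (\<integral>\<^sup>+u. indicator {a<..<0} u \<partial>lborel)"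
        by (intro nn_integral_cong) (auto simp: indicator_def)
      finally show ?thesis by simp
    qed
    also have "\<dots> = emeasure lborel ?S" by (cases "a < 0") auto
    finally show "emeasure (distr (density lborel (\<lambda>x. ennreal (h x))) borel (\<lambda>x. - U x)) {a<..}
        = emeasure (density lborel (indicator {..<0})) {a<..}" using L by simp
    show "emeasure (distr (density lborel (\<lambda>x. ennreal (h x))) borel (\<lambda>x. - U x)) {a<..} < \<infinity>"
      unfolding L by (cases "a < 0") auto
  qed simp_all
  have reflect: "(\<lambda>x. indicator {0<..} (- x)) = (indicator {..<0} :: real \<Rightarrow> ennreal)"
    by (auto simp: indicator_def fun_eq_iff)
  have "distr (density lborel (\<lambda>x. ennreal (h x))) borel U
      = distr (distr (density lborel (\<lambda>x. ennreal (h x))) borel (\<lambda>x. - U x)) borel uminus"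
    by (subst distr_distr) (auto simp: o_def)
  also have "\<dots> = distr (density lborel (indicator {..<0})) borel uminus"
    by (simp only: *)
  also have "\<dots> = density (distr lborel borel uminus) (indicator {0<..})"
    by (subst density_distr) (simp_all add: reflect)
  also have "\<dots> = density lborel (indicator {0<..})"
    by (simp add: lborel_distr_uminus)
  finally show ?thesis .
qed

text \<open>The substitution rule obtained from \<open>distr_U\<close>.\<close>

lemma nn_integral_h_U:
  assumes [measurable]: "g \<in> borel_measurable borel"
  shows "(\<integral>\<^sup>+x. ennreal (h x) * g (U x) \<partial>lborel) = (\<integral>\<^sup>+u. indicator {0<..} u * g u \<partial>lborel)"
proof -
  have "(\<integral>\<^sup>+x. ennreal (h x) * g (U x) \<partial>lborel)
      = (\<integral>\<^sup>+u. g u \<partial>distr (density lborel (\<lambda>x. ennreal (h x))) borel U)"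
    by (subst nn_integral_distr) (auto simp: nn_integral_density)
  also have "\<dots> = (\<integral>\<^sup>+u. indicator {0<..} u * g u \<partial>lborel)"
    unfolding distr_U by (subst nn_integral_density) auto
  finally show ?thesis .
qed

section \<open>Integration over ordered chains and the law of the last coordinate\<close>

lemma chain_measurable [measurable]:
  "Measurable.pred (PiM {1..Suc k} (\<lambda>_. lborel)) (\<lambda>x. \<forall>j\<in>{1..k}. U (x j) < U (x (Suc j)))"
proof (intro pred_intros_finite)
  fix j assume "j \<in> {1..k}"
  then have [measurable]: "(\<lambda>x. x j) \<in> PiM {1..Suc k} (\<lambda>_. lborel) \<rightarrow>\<^sub>M borel"
    "(\<lambda>x. x (Suc j)) \<in> PiM {1..Suc k} (\<lambda>_. lborel) \<rightarrow>\<^sub>M borel"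
    using measurable_component_singleton[of _ "{1..Suc k}" "\<lambda>_. lborel :: real measure"] by auto
  show "Measurable.pred (PiM {1..Suc k} (\<lambda>_. lborel)) (\<lambda>x. U (x j) < U (x (Suc j)))"
    by measurable
qed simp

lemma prod_h_measurable [measurable]:
  "(\<lambda>x. \<Prod>j=1..k. ennreal (h (x j))) \<in> borel_measurable (PiM {1..k} (\<lambda>_. lborel))"
proof (intro borel_measurable_prod_ennreal)
  fix j assume "j \<in> {1..k}"
  then have [measurable]: "(\<lambda>x. x j) \<in> PiM {1..k} (\<lambda>_. lborel) \<rightarrow>\<^sub>M borel"
    using measurable_component_singleton[of j "{1..k}" "\<lambda>_. lborel :: real measure"] by simp
  show "(\<lambda>x. ennreal (h (x j))) \<in> borel_measurable (PiM {1..k} (\<lambda>_. lborel))" by measurable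
qed

lemma component_measurable:
  "j \<in> I \<Longrightarrow> (\<lambda>x. x j) \<in> PiM I (\<lambda>_. lborel :: real measure) \<rightarrow>\<^sub>M borel"
  using measurable_component_singleton[of j I "\<lambda>_. lborel :: real measure"] by simp

text \<open>Once the last point is fixed at \<open>u\<close>, the earlier ordered points fill a
  simplex of volume \<open>u ^ k / fact k\<close>. The function \<open>g\<close> is arbitrary so
  that the induction can use it to carry the next order constraint.\<close>

lemma nn_integral_chain:
  assumes "g \<in> borel_measurable borel"
  shows "(\<integral>\<^sup>+x. (\<Prod>j=1..Suc k. ennreal (h (x j))) *
      ((if \<forall>j\<in>{1..k}. U (x j) < U (x (Suc j)) then 1 else 0) * g (U (x (Suc k)))) \<partial>PiM {1..Suc k} (\<lambda>_. lborel))
    = (\<integral>\<^sup>+u. indicator {0<..} u * (ennreal (u ^ k / fact k) * g u) \<partial>lborel)"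
  using assms
proof (induction k arbitrary: g)
  case 0
  note [measurable] = 0
  interpret product_sigma_finite "\<lambda>_::nat. lborel :: real measure"
    by unfold_locales
  have "(\<integral>\<^sup>+x. ennreal (h (x 1)) * g (U (x 1)) \<partial>PiM {1::nat} (\<lambda>_. lborel))
      = (\<integral>\<^sup>+x. ennreal (h x) * g (U x) \<partial>lborel)"
    by (rule product_nn_integral_singleton) measurable
  then show ?case
    by (simp add: nn_integral_h_U)
next
  case (Suc k)
  note [measurable] = Suc.prems
  interpret product_sigma_finite "\<lambda>_::nat. lborel :: real measure"
    by unfold_locales
  let ?P = "PiM {1..Suc k} (\<lambda>_. lborel :: real measure)"
  let ?c = "\<lambda>k x. if \<forall>j\<in>{1..k}. U (x j) < U (x (Suc j)) then 1 else 0 :: ennreal"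
  let ?F = "\<lambda>k x. (\<Prod>j=1..Suc k. ennreal (h (x j)))"
  let ?G = "\<lambda>x. ?F (Suc k) x * (?c (Suc k) x * g (U (x (Suc (Suc k)))))"
  have ins: "{1..Suc (Suc k)} = insert (Suc (Suc k)) {1..Suc k}" by auto
  have "?G \<in> borel_measurable (PiM {1..Suc (Suc k)} (\<lambda>_. lborel))" by measurable
  then have "integral\<^sup>N (PiM {1..Suc (Suc k)} (\<lambda>_. lborel)) ?G
      = (\<integral>\<^sup>+y. (\<integral>\<^sup>+x. ?G (x(Suc (Suc k) := y)) \<partial>?P) \<partial>lborel)"
    unfolding ins by (intro product_nn_integral_insert_rev) auto
  also have "\<dots> = (\<integral>\<^sup>+y. ennreal (h y) * (g (U y) * ennreal (U y ^ Suc k / fact (Suc k))) \<partial>lborel)"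
  proof (intro nn_integral_cong)
    fix y :: real
    \<comment> \<open>With the last coordinate \<open>y\<close> held fixed, the final link of the
      chain becomes the test function for the induction hypothesis.\<close>
    let ?g = "indicator {..<U y} :: real \<Rightarrow> ennreal"
    have G: "?G (x(Suc (Suc k) := y)) = (ennreal (h y) * g (U y)) * (?F k x * (?c k x * ?g (U (x (Suc k)))))" for x
    proof -
      have "(\<Prod>j=1..Suc k. ennreal (h ((x(Suc (Suc k) := y)) j))) = ?F k x"
        by (intro prod.cong) auto
      then have F: "?F (Suc k) (x(Suc (Suc k) := y)) = ennreal (h y) * ?F k x"
        unfolding ins by (subst prod.insert) auto
      have "{1..Suc k} = insert (Suc k) {1..k}" by auto
      then have "?c (Suc k) (x(Suc (Suc k) := y)) = ?c k x * ?g (U (x (Suc k)))"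
        by (auto simp: indicator_def)
      then show ?thesis unfolding F by (simp add: mult_ac)
    qed
    have "(\<integral>\<^sup>+x. ?G (x(Suc (Suc k) := y)) \<partial>?P)
        = (ennreal (h y) * g (U y)) * (\<integral>\<^sup>+x. ?F k x * (?c k x * ?g (U (x (Suc k)))) \<partial>?P)"
      unfolding G by (intro nn_integral_cmult) measurable
    also have "\<dots> = (ennreal (h y) * g (U y)) * ennreal (U y ^ Suc k / fact (Suc k))"
      by (subst Suc.IH) (simp_all add: nn_integral_power_half_open U_nonneg del: fact_Suc power_Suc)
    finally show "(\<integral>\<^sup>+x. ?G (x(Suc (Suc k) := y)) \<partial>?P)
        = ennreal (h y) * (g (U y) * ennreal (U y ^ Suc k / fact (Suc k)))"
      by (simp add: mult_ac)
  qed
  also have "\<dots> = (\<integral>\<^sup>+u. indicator {0<..} u * (g u * ennreal (u ^ Suc k / fact (Suc k))) \<partial>lborel)"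
    by (rule nn_integral_h_U[where g = "\<lambda>u. g u * ennreal (u ^ Suc k / fact (Suc k))"]) measurable
  finally show ?case by (simp add: mult_ac)
qed

text \<open>On \<open>supp\<close>, the factor \<open>U powr (1 + \<xi>) / \<sigma>\<close> collects
  one term of the exponent, and decreasing \<open>x\<close> means increasing \<open>U\<close>. If
  some coordinate leaves \<open>supp\<close>, both sides are 0. The product form is the integrand of
  \<open>nn_integral_chain\<close>.\<close>

lemma gevr_density_eq:
  "ennreal (gevr_density (Suc k) \<mu> \<sigma> \<xi> x) = (\<Prod>j=1..Suc k. ennreal (h (x j))) *
    ((if \<forall>j\<in>{1..k}. U (x j) < U (x (Suc j)) then 1 else 0) * ennreal (exp (- U (x (Suc k)))))"
proof (cases "\<forall>j\<in>{1..Suc k}. x j \<in> supp")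
  case False
  then obtain j where "j \<in> {1..Suc k}" "x j \<notin> supp" by auto
  then have "(\<Prod>j=1..Suc k. ennreal (h (x j))) = 0"
    by (intro prod_zero bexI[of _ j]) (simp_all add: h_def)
  moreover have "\<not> gevr_support (Suc k) \<mu> \<sigma> \<xi> x"
    using False by (auto simp: gevr_support_def supp_def)
  ultimately show ?thesis by (simp add: gevr_density_def)
next
  case True
  have "(\<forall>j\<in>{1..k}. U (x j) < U (x (Suc j))) \<longleftrightarrow> gevr_support (Suc k) \<mu> \<sigma> \<xi> x"
  proof -
    have "gevr_support (Suc k) \<mu> \<sigma> \<xi> x \<longleftrightarrow> (\<forall>j\<in>{1..k}. x (Suc j) < x j)"
      using True unfolding gevr_support_def atLeastLessThanSuc_atLeastAtMost by (auto simp: supp_def)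
    also have "\<dots> \<longleftrightarrow> (\<forall>j\<in>{1..k}. U (x j) < U (x (Suc j)))"
      using True by (intro ball_cong refl U_strict_antimono) auto
    finally show ?thesis ..
  qed
  moreover have "gevr_density (Suc k) \<mu> \<sigma> \<xi> x = (\<Prod>j=1..Suc k. h (x j)) * exp (- U (x (Suc k)))"
    if "gevr_support (Suc k) \<mu> \<sigma> \<xi> x"
  proof -
    have "h (x j) = exp ((1 + \<xi>) * ln (U (x j))) / \<sigma>" if "j \<in> {1..Suc k}" for j
      using True that U_pos[of "x j"] by (auto simp: h_def powr_def)
    then have "(\<Prod>j=1..Suc k. h (x j)) = (\<Prod>j=1..Suc k. exp ((1 + \<xi>) * ln (U (x j))) / \<sigma>)"
      by (intro prod.cong) auto
    also have "\<dots> = exp (\<Sum>j=1..Suc k. (1 + \<xi>) * ln (U (x j))) / \<sigma> ^ Suc k"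
      by (simp only: prod_dividef exp_sum[OF finite_atLeastAtMost] prod_constant card_atLeastAtMost) simp
    finally have P: "(\<Prod>j=1..Suc k. h (x j)) = exp (\<Sum>j=1..Suc k. (1 + \<xi>) * ln (U (x j))) / \<sigma> ^ Suc k" .
    show ?thesis
    proof (cases "\<xi> = 0")
      case xi: True
      have S: "(\<Sum>j=1..Suc k. (1 + \<xi>) * ln (U (x j))) = - (\<Sum>j=1..Suc k. gev_z \<mu> \<sigma> (x j))"
        unfolding ln_U if_P[OF xi] by (simp add: xi sum_negf del: sum.cl_ivl_Suc)
      have "U (x (Suc k)) = exp (- gev_z \<mu> \<sigma> (x (Suc k)))"
        unfolding U_def if_P[OF xi] ..
      then show ?thesis
        unfolding P gevr_density_def if_P[OF xi] if_P[OF that] S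
        by (simp add: mult_exp_exp del: sum.cl_ivl_Suc)
    next
      case xi: False
      have "(1 + \<xi>) * ln (U (x j)) = - ((1 / \<xi> + 1) * ln (1 + \<xi> * gev_z \<mu> \<sigma> (x j)))" for j
        using xi by (simp add: ln_U field_simps)
      then have S: "(\<Sum>j=1..Suc k. (1 + \<xi>) * ln (U (x j)))
          = - ((1 / \<xi> + 1) * (\<Sum>j=1..Suc k. ln (1 + \<xi> * gev_z \<mu> \<sigma> (x j))))"
        by (simp only: sum_negf sum_distrib_left)
      have "U (x (Suc k)) = (1 + \<xi> * gev_z \<mu> \<sigma> (x (Suc k))) powr (- 1 / \<xi>)"
        unfolding U_def if_not_P[OF xi] ..
      then show ?thesis
        unfolding P gevr_density_def if_not_P[OF xi] if_P[OF that] S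
        by (simp add: mult_exp_exp del: sum.cl_ivl_Suc)
    qed
  qed
  moreover have "\<not> gevr_support (Suc k) \<mu> \<sigma> \<xi> x \<Longrightarrow> gevr_density (Suc k) \<mu> \<sigma> \<xi> x = 0"
    by (simp add: gevr_density_def)
  ultimately show ?thesis
    using h_nonneg by (simp add: ennreal_mult prod_ennreal prod_nonneg del: prod.cl_ivl_Suc)
qed

lemma gevr_density_measurable [measurable]:
  "(\<lambda>x. ennreal (gevr_density (Suc k) \<mu> \<sigma> \<xi> x)) \<in> borel_measurable (PiM {1..Suc k} (\<lambda>_. lborel))"
proof -
  have [measurable]: "(\<lambda>x. x (Suc k)) \<in> PiM {1..Suc k} (\<lambda>_. lborel :: real measure) \<rightarrow>\<^sub>M borel"
    by measurable
  show ?thesis unfolding gevr_density_eq by measurable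
qed

text \<open>Integrating out all earlier coordinates multiplies \<open>exp (- u)\<close> by the
  simplex volume \<open>u ^ k / fact k\<close>, which is the Erlang density of shape
  \<open>k + 1\<close>.\<close>

theorem distr_GEVr_last:
  "distr (GEVr (Suc k) \<mu> \<sigma> \<xi>) borel (\<lambda>x. U (x (Suc k)))
    = density lborel (\<lambda>u. ennreal (erlang_density k 1 u))"
proof (rule measure_eqI)
  fix A assume "A \<in> sets (distr (GEVr (Suc k) \<mu> \<sigma> \<xi>) borel (\<lambda>x. U (x (Suc k))))"
  then have A[measurable]: "A \<in> sets borel" by simp
  let ?P = "PiM {1..Suc k} (\<lambda>_. lborel :: real measure)"
  have comp[measurable]: "(\<lambda>x. x (Suc k)) \<in> ?P \<rightarrow>\<^sub>M borel"
    by measurable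
  have sets: "sets (GEVr (Suc k) \<mu> \<sigma> \<xi>) = sets ?P" by (simp add: GEVr_def)
  have meas: "(\<lambda>x. U (x (Suc k))) \<in> borel_measurable (GEVr (Suc k) \<mu> \<sigma> \<xi>)"
    unfolding measurable_cong_sets[OF sets refl] by measurable
  have "emeasure (distr (GEVr (Suc k) \<mu> \<sigma> \<xi>) borel (\<lambda>x. U (x (Suc k)))) A
      = (\<integral>\<^sup>+x. indicator A (U (x (Suc k))) \<partial>GEVr (Suc k) \<mu> \<sigma> \<xi>)"
    using nn_integral_distr[OF meas, of "indicator A"] by simp
  also have "\<dots> = (\<integral>\<^sup>+x. ennreal (gevr_density (Suc k) \<mu> \<sigma> \<xi> x) * indicator A (U (x (Suc k))) \<partial>?P)"
    unfolding GEVr_def by (rule nn_integral_density) measurable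
  also have "\<dots> = (\<integral>\<^sup>+x. (\<Prod>j=1..Suc k. ennreal (h (x j))) *
      ((if \<forall>j\<in>{1..k}. U (x j) < U (x (Suc j)) then 1 else 0) *
        (\<lambda>u. ennreal (exp (- u)) * indicator A u) (U (x (Suc k)))) \<partial>?P)"
    unfolding gevr_density_eq by (simp only: mult.assoc)
  also have "\<dots> = (\<integral>\<^sup>+u. indicator {0<..} u * (ennreal (u ^ k / fact k) * (ennreal (exp (- u)) * indicator A u)) \<partial>lborel)"
    by (rule nn_integral_chain) measurable
  also have "\<dots> = (\<integral>\<^sup>+u. ennreal (erlang_density k 1 u) * indicator A u \<partial>lborel)"
  proof (rule nn_integral_cong_AE)
    \<comment> \<open>For \<open>k = 0\<close> the sides can differ at \<open>u = 0\<close>, where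
      only the Erlang density is nonzero; that point is a null set.\<close>
    show "AE u in lborel. indicator {0<..} u * (ennreal (u ^ k / fact k) * (ennreal (exp (- u)) * indicator A u))
        = ennreal (erlang_density k 1 u) * indicator A u"
      using AE_lborel_singleton[of 0]
    proof eventually_elim
      case (elim u)
      then show ?case
        by (auto simp: erlang_density_def indicator_def simp flip: ennreal_mult)
    qed
  qed
  also have "\<dots> = emeasure (density lborel (\<lambda>u. ennreal (erlang_density k 1 u))) A"
    by (rule emeasure_density[symmetric]) simp_all
  finally show "emeasure (distr (GEVr (Suc k) \<mu> \<sigma> \<xi>) borel (\<lambda>x. U (x (Suc k)))) A
    = emeasure (density lborel (\<lambda>u. ennreal (erlang_density k 1 u))) A" .
qed simp

section \<open>Non-degeneracy and the form of the statistic\<close>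

text \<open>By Tonelli with the next-to-last coordinate innermost: given the others, injectivity of
  \<open>U\<close> on \<open>supp\<close> leaves at most one bad value, a null set. This will
  exclude zero variance.\<close>

lemma AE_GEVr_not_graph:
  assumes [measurable]: "\<phi> \<in> borel_measurable borel"
  shows "AE x in GEVr (Suc (Suc k)) \<mu> \<sigma> \<xi>. U (x (Suc k)) \<noteq> \<phi> (x (Suc (Suc k)))"
proof -
  interpret product_sigma_finite "\<lambda>_::nat. lborel :: real measure"
    by unfold_locales
  let ?r = "Suc (Suc k)"
  define J where "J = {1..Suc (Suc k)} - {Suc k}"
  let ?P = "PiM {1..?r} (\<lambda>_. lborel :: real measure)"
  have [measurable]: "(\<lambda>x. x ?r) \<in> ?P \<rightarrow>\<^sub>M borel" "(\<lambda>x. x (Suc k)) \<in> ?P \<rightarrow>\<^sub>M borel"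
    by measurable
  have ins: "{1..?r} = insert (Suc k) J" and J: "finite J" "Suc k \<notin> J" by (auto simp: J_def)
  let ?f = "\<lambda>x. ennreal (gevr_density ?r \<mu> \<sigma> \<xi> x) * (if U (x (Suc k)) = \<phi> (x ?r) then 1 else 0)"
  have "?f \<in> borel_measurable ?P" by measurable
  then have "(\<integral>\<^sup>+x. ?f x \<partial>?P) = (\<integral>\<^sup>+x. (\<integral>\<^sup>+y. ?f (x(Suc k := y)) \<partial>lborel) \<partial>PiM J (\<lambda>_. lborel))"
    unfolding ins by (rule product_nn_integral_insert[OF J])
  also have "\<dots> = (\<integral>\<^sup>+x. 0 \<partial>PiM J (\<lambda>_. lborel :: real measure))"
  proof (rule nn_integral_cong)
    fix x :: "nat \<Rightarrow> real"
    have "AE y in lborel. ?f (x(Suc k := y)) = 0"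
      \<comment> \<open>The only point of \<open>supp\<close> that \<open>U\<close> can send to
        \<open>\<phi> (x ?r)\<close> is its image under \<open>V\<close>.\<close>
      using AE_lborel_singleton[of "V (\<phi> (x ?r))"]
    proof eventually_elim
      case (elim y)
      have "y \<in> supp \<Longrightarrow> U y \<noteq> \<phi> (x ?r)" using V_U[of y] elim by auto
      moreover have "y \<notin> supp \<Longrightarrow> (\<Prod>j=1..?r. ennreal (h ((x(Suc k := y)) j))) = 0"
        by (intro prod_zero bexI[of _ "Suc k"]) (simp_all add: h_def)
      ultimately show ?case unfolding gevr_density_eq by (cases "y \<in> supp") auto
    qed
    then show "(\<integral>\<^sup>+y. ?f (x(Suc k := y)) \<partial>lborel) = 0"
      by (subst nn_integral_cong_AE[where v = "\<lambda>_. 0"]) simp_all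
  qed
  finally have "(\<integral>\<^sup>+x. ?f x \<partial>?P) = 0" by simp
  then have "AE x in ?P. ?f x = 0" by (subst (asm) nn_integral_0_iff_AE) measurable
  then show ?thesis
    unfolding GEVr_def by (subst AE_density[OF gevr_density_measurable]) (auto elim!: eventually_mono split: if_splits)
qed

text \<open>Merges the cases of zero and nonzero \<open>\<xi>\<close>, reducing all moments to those
  of \<open>U\<close> and \<open>ln U\<close>.\<close>

lemma gev_Y_eq: "gev_Y \<mu> \<sigma> \<xi> a b = - ln \<sigma> - U b + U a + (1 + \<xi>) * ln (U b)"
  unfolding ln_U by (simp add: gev_Y_def U_def field_simps)

end

section \<open>Asymptotic normality\<close>

theorem theorem1:
  fixes M :: "'a measure" and X :: "nat \<Rightarrow> nat \<Rightarrow> 'a \<Rightarrow> real"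
    and r :: nat and \<mu> \<sigma> \<xi> :: real
  assumes "prob_space M"
    and r_ge: "r \<ge> 2"
    and sigma_pos: "\<sigma> > 0"
    and indep: "prob_space.indep_vars M (\<lambda>i. PiM {1..r} (\<lambda>_. lborel))
                  (\<lambda>i \<omega>. \<lambda>j\<in>{1..r}. X i j \<omega>) UNIV"
    and distr_r: "\<And>i. distr M (PiM {1..r} (\<lambda>_. lborel)) (\<lambda>\<omega>. \<lambda>j\<in>{1..r}. X i j \<omega>)
                    = GEVr r \<mu> \<sigma> \<xi>"
    and H0: "\<And>i. distr M (PiM {1..r-1} (\<lambda>_. lborel)) (\<lambda>\<omega>. \<lambda>j\<in>{1..r-1}. X i j \<omega>)
                    = GEVr (r - 1) \<mu> \<sigma> \<xi>"
  shows "weak_conv_m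
           (\<lambda>n. distr M borel
              (\<lambda>\<omega>. gev_T n (gev_eta r \<sigma> \<xi>) (\<lambda>i. gev_Y \<mu> \<sigma> \<xi> (X i (r - 1) \<omega>) (X i r \<omega>))))
           std_normal_distribution"
proof -
  interpret prob_space M by fact
  interpret gev \<mu> \<sigma> \<xi> by standard fact
  \<comment> \<open>Thus the coordinates \<open>r - 1\<close> and \<open>r\<close> are
    \<open>Suc k\<close> and \<open>Suc (Suc k)\<close>, and their images under \<open>U\<close>
    have \<open>erlang_density k\<close> and \<open>erlang_density (Suc k)\<close>.\<close>
  obtain k where r: "r = Suc (Suc k)" using that[of "r - 2"] r_ge by simp
  let ?P = "PiM {1..r} (\<lambda>_. lborel :: real measure)" and ?Q = "PiM {1..r-1} (\<lambda>_. lborel :: real measure)"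
  let ?D = "\<lambda>k. density lborel (\<lambda>u. ennreal (erlang_density k 1 u))"
  have vec: "(\<lambda>\<omega>. \<lambda>j\<in>{1..r}. X i j \<omega>) \<in> M \<rightarrow>\<^sub>M ?P" for i
    using indep by (auto simp: indep_vars_def)
  have X: "X i j \<in> borel_measurable M" if "j \<in> {1..r}" for i j
    using measurable_compose[OF vec component_measurable[OF that]] that by simp
  have vec': "(\<lambda>\<omega>. \<lambda>j\<in>{1..r-1}. X i j \<omega>) \<in> M \<rightarrow>\<^sub>M ?Q" for i
    by (rule measurable_restrict) (use X in auto)
  have Xk[measurable]: "X i (Suc k) \<in> borel_measurable M" "X i (Suc (Suc k)) \<in> borel_measurable M" for i
    using X r by auto
  define Y where "Y i \<omega> = gev_Y \<mu> \<sigma> \<xi> (X i (Suc k) \<omega>) (X i (Suc (Suc k)) \<omega>)" for i \<omega>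
  define f where "f x = - ln \<sigma> - U (x (Suc (Suc k))) + U (x (Suc k)) + (1 + \<xi>) * ln (U (x (Suc (Suc k))))"
    for x :: "nat \<Rightarrow> real"
  \<comment> \<open>As a function of the whole block vector, \<open>Y i\<close> inherits
    independence and a common law from the blocks.\<close>
  have Yf: "Y i = (\<lambda>\<omega>. f (\<lambda>j\<in>{1..r}. X i j \<omega>))" for i
    by (auto simp: Y_def f_def gev_Y_eq r)
  have compP: "(\<lambda>x. x (Suc k)) \<in> borel_measurable ?P" "(\<lambda>x. x (Suc (Suc k))) \<in> borel_measurable ?P"
    by (rule component_measurable; simp add: r)+
  have f: "f \<in> borel_measurable ?P"
    unfolding f_def by (intro borel_measurable_add borel_measurable_diff borel_measurable_times
        borel_measurable_const borel_measurable_ln measurable_compose[OF compP(1) measurable_gev(2)]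
        measurable_compose[OF compP(2) measurable_gev(2)])
  have Y[measurable]: "Y i \<in> borel_measurable M" for i
    unfolding Yf by (rule measurable_compose[OF vec f])
  have indY: "indep_vars (\<lambda>_. borel) Y UNIV"
    unfolding Yf[abs_def] by (rule indep_vars_compose2[OF indep]) (rule f)
  have dY: "distr M borel (Y i) = distr (GEVr r \<mu> \<sigma> \<xi>) borel f" for i
    unfolding Yf distr_r[of i, symmetric] by (subst distr_distr[OF f vec]) (simp add: o_def)
  have dU: "distr M borel (\<lambda>\<omega>. U (X i (Suc (Suc k)) \<omega>)) = ?D (Suc k)" for i
  proof -
    have "(\<lambda>x. U (x (Suc (Suc k)))) \<in> borel_measurable ?P"
      by (rule measurable_compose[OF compP(2) measurable_gev(2)])
    then have "distr M borel (\<lambda>\<omega>. U (X i (Suc (Suc k)) \<omega>)) = distr (GEVr r \<mu> \<sigma> \<xi>) borel (\<lambda>x. U (x (Suc (Suc k))))"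
      unfolding distr_r[of i, symmetric] by (subst distr_distr[OF _ vec]) (simp_all add: o_def r)
    then show ?thesis by (simp only: r distr_GEVr_last)
  qed
  \<comment> \<open>Here the null hypothesis enters: coordinate \<open>r - 1\<close> is the last one
    of a \<open>GEVr (r - 1)\<close> vector.\<close>
  have dU': "distr M borel (\<lambda>\<omega>. U (X i (Suc k) \<omega>)) = ?D k" for i
  proof -
    have "(\<lambda>x. U (x (Suc k))) \<in> borel_measurable ?Q"
      by (rule measurable_compose[OF component_measurable measurable_gev(2)]) (simp add: r)
    then have "distr M borel (\<lambda>\<omega>. U (X i (Suc k) \<omega>)) = distr (GEVr (r - 1) \<mu> \<sigma> \<xi>) borel (\<lambda>x. U (x (Suc k)))"
      unfolding H0[of i, symmetric] by (subst distr_distr[OF _ vec']) (simp_all add: o_def r)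
    then show ?thesis by (simp only: r diff_Suc_1 distr_GEVr_last)
  qed
  have push: "integrable M (\<lambda>\<omega>. g (U (X i (Suc (Suc k)) \<omega>)))"
      "expectation (\<lambda>\<omega>. g (U (X i (Suc (Suc k)) \<omega>))) = v"
    if "has_bochner_integral (?D (Suc k)) g v" "g \<in> borel_measurable borel" for g :: "real \<Rightarrow> real" and v i
    using that integrable_distr_eq[of "\<lambda>\<omega>. U (X i (Suc (Suc k)) \<omega>)" M borel g]
      integral_distr[of "\<lambda>\<omega>. U (X i (Suc (Suc k)) \<omega>)" M borel g]
    by (auto simp: has_bochner_integral_iff dU)
  have push': "integrable M (\<lambda>\<omega>. g (U (X i (Suc k) \<omega>)))"
      "expectation (\<lambda>\<omega>. g (U (X i (Suc k) \<omega>))) = v"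
    if "has_bochner_integral (?D k) g v" "g \<in> borel_measurable borel" for g :: "real \<Rightarrow> real" and v i
    using that integrable_distr_eq[of "\<lambda>\<omega>. U (X i (Suc k) \<omega>)" M borel g]
      integral_distr[of "\<lambda>\<omega>. U (X i (Suc k) \<omega>)" M borel g]
    by (auto simp: has_bochner_integral_iff dU')
  note id = push[OF has_bochner_integral_erlang_id] push'[OF has_bochner_integral_erlang_id]
  note ln = push[OF has_bochner_integral_erlang_ln]
  \<comment> \<open>Nested binary sums with explicit coefficients fit
    \<open>integrable_power4_add\<close> and linearity of the expectation.\<close>
  have Y_eq: "Y i = (\<lambda>\<omega>. ((- ln \<sigma> + - 1 * U (X i (Suc (Suc k)) \<omega>)) + U (X i (Suc k) \<omega>))
      + (1 + \<xi>) * ln (U (X i (Suc (Suc k)) \<omega>)))" for i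
    by (simp add: Y_def gev_Y_eq fun_eq_iff)
  \<comment> \<open>The means \<open>r\<close> and \<open>r - 1\<close> of the two Erlang variables
    leave the \<open>- 1\<close> in \<open>gev_eta\<close>, and the logarithm contributes
    \<open>Digamma (real r)\<close>.\<close>
  have mean: "expectation (Y i) = gev_eta r \<sigma> \<xi>" for i
    unfolding Y_eq using id[of i] ln[of i] by (simp add: gev_eta_def r prob_space)
  have "integrable M (\<lambda>\<omega>. U (X i (Suc (Suc k)) \<omega>) ^ 4)" "integrable M (\<lambda>\<omega>. U (X i (Suc k) \<omega>) ^ 4)"
    "integrable M (\<lambda>\<omega>. ln (U (X i (Suc (Suc k)) \<omega>)) ^ 4)" for i
    using push(1)[OF has_bochner_integral_integrable[OF integrable_erlang_power]]
      push'(1)[OF has_bochner_integral_integrable[OF integrable_erlang_power]]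
      push(1)[OF has_bochner_integral_integrable[OF integrable_erlang_ln_power4]] by simp_all
  then have Y4: "integrable M (\<lambda>\<omega>. Y i \<omega> ^ 4)" for i
    unfolding Y_eq by (intro integrable_power4_add) (simp_all add: power_mult_distrib)
  have sqY: "integrable M (\<lambda>\<omega>. (Y i \<omega>)\<^sup>2)" for i
    by (rule square_integrable_imp_integrable) (use Y4 in \<open>simp_all flip: power_mult\<close>)
  have varY: "variance (Y i) = (LINT y|distr (GEVr r \<mu> \<sigma> \<xi>) borel f. (y - gev_eta r \<sigma> \<xi>)\<^sup>2)" for i
    unfolding mean dY[of i, symmetric] by (subst integral_distr) simp_all
  \<comment> \<open>Zero variance would make \<open>Y 0\<close> almost surely constant and so force
    the block vector onto a graph that it almost surely avoids.\<close>
  have "variance (Y 0) \<noteq> 0"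
  proof
    assume "variance (Y 0) = 0"
    moreover have "integrable M (\<lambda>\<omega>. (Y 0 \<omega> - gev_eta r \<sigma> \<xi>)\<^sup>2)"
      unfolding power2_diff using sqY[of 0] square_integrable_imp_integrable[OF Y sqY, of 0] by simp
    ultimately have "AE \<omega> in M. Y 0 \<omega> = gev_eta r \<sigma> \<xi>"
      unfolding mean by (subst (asm) integral_nonneg_eq_0_iff_AE) auto
    moreover have "AE x in GEVr r \<mu> \<sigma> \<xi>. f x \<noteq> gev_eta r \<sigma> \<xi>"
    proof -
      \<comment> \<open>The equation \<open>f x = gev_eta r \<sigma> \<xi>\<close> solved for
        \<open>U (x (Suc k))\<close>.\<close>
      let ?\<phi> = "\<lambda>t. gev_eta r \<sigma> \<xi> + ln \<sigma> + U t - (1 + \<xi>) * ln (U t)"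
      have "AE x in GEVr (Suc (Suc k)) \<mu> \<sigma> \<xi>. U (x (Suc k)) \<noteq> ?\<phi> (x (Suc (Suc k)))"
        by (rule AE_GEVr_not_graph) measurable
      then show ?thesis unfolding r[symmetric]
        by eventually_elim (auto simp: f_def r)
    qed
    then have "AE \<omega> in M. Y 0 \<omega> \<noteq> gev_eta r \<sigma> \<xi>"
      unfolding distr_r[of 0, symmetric] Yf by (rule AE_distrD[OF vec])
    ultimately have "AE \<omega> in M. False" by eventually_elim simp
    then show False by simp
  qed
  moreover have "variance (Y 0) \<ge> 0" by (rule variance_positive)
  ultimately have "variance (Y 0) > 0" by linarith
  then have s: "sqrt (variance (Y 0)) > 0" by simp
  have "weak_conv_m (\<lambda>n. distr M borel (\<lambda>\<omega>. gev_T n (gev_eta r \<sigma> \<xi>) (\<lambda>i. Y i \<omega>))) std_normal_distribution"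
    by (rule studentized_central_limit_theorem[OF indY dY Y4 mean s]) (simp add: varY)
  then show ?thesis by (simp add: Y_def r)
qed

end
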